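(* Let $A$ be a semi-simple complex unital Banach algebra with unit $e$, let $J=\operatorname{soc}(A)$ be its socle, and let $\pi:A\to A/J$ be the canonical projection. Let $a\in A$ be a B-Fredholm element of $A$ modulo $J$. Then there is $\varepsilon>0$ such that for every $\lambda\in\mathbb{C}$ with $0<|\lambda|<\varepsilon$, the element $a-\lambda e$ is a Fredholm element of $A$ modulo $J$ and $\mathbf{i}(a-\lambda e)=\mathbf{i}(a)$.
   Context: An element $x$ of an algebra $B$ is Drazin invertible if there exist $y\in B$ and $k\ge1$ with $xy=yx$, $yxy=y$, $x^kyx=x^k$; $y$ is unique and called the Drazin inverse of $x$. An element $a\in A$ is B-Fredholm modulo $J$ if $\pi(a)$ is Drazin invertible in $A/J$, and Fredholm modulo $J$ if $\pi(a)$ is invertible in $A/J$. The socle $\operatorname{soc}(A)$ is the sum of all minimal left ideals of $A$ (equivalently, the set of $x\in A$ such that left multiplication by $x$ on $Ap$ is of finite rank, for minimal idempotents $p$). On $\operatorname{soc}(A)$ the trace is $\tau(x)=\sum_{\lambda\in\sigma(x)}m(\lambda,x)\lambda$, where $\sigma(x)$ is the (finite) spectrum of $x$ and, for $\lambda\neq0$, $m(\lambda,x)$ is the algebraic multiplicity of $\lambda$, namely the rank of the Riesz projection of $x$ associated with $\lambda$, the rank of an element $u$ being $\sup_{y\in A}\#(\sigma(yu)\setminus\{0\})$. For an element $a$ that is B-Fredholm (in particular Fredholm) modulo $J$, its index is $\mathbf{i}(a)=\tau(aa_0-a_0a)$, where $a_0\in A$ is any element with $\pi(a_0)$ the Drazin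 inverse (for Fredholm elements, the inverse) of $\pi(a)$; this does not depend on the choice of $a_0$. *)

theory Defs
  imports "HOL-Analysis.Analysis"
begin

text \<open>Isabelle/HOL has no class of complex vector spaces, so a complex unital
Banach algebra is a real unital Banach algebra (with norm 1 = 1) equipped with a
complex scalar multiplication compatible with the real one, the norm, and the
product.\<close>

class complex_banach_algebra_1 = real_normed_algebra_1 + banach +
  fixes cscale :: "complex \<Rightarrow> 'a \<Rightarrow> 'a"  (infixr "*\<^sub>C" 75)
  assumes cscale_add_right: "c *\<^sub>C (x + y) = c *\<^sub>C x + c *\<^sub>C y"
    and cscale_add_left: "(c + d) *\<^sub>C x = c *\<^sub>C x + d *\<^sub>C x"
    and cscale_cscale: "c *\<^sub>C (d *\<^sub>C x) = (c * d) *\<^sub>C x"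
    and cscale_one: "(1::complex) *\<^sub>C x = x"
    and cscale_of_real: "(complex_of_real r) *\<^sub>C x = scaleR r x"
    and norm_cscale: "norm (c *\<^sub>C x) = cmod c * norm x"
    and cscale_mult_left: "(c *\<^sub>C x) * y = c *\<^sub>C (x * y)"
    and cscale_mult_right: "x * (c *\<^sub>C y) = c *\<^sub>C (x * y)"

definition left_ideal :: "'a::complex_banach_algebra_1 set \<Rightarrow> bool" where
  "left_ideal L \<longleftrightarrow> 0 \<in> L \<and> (\<forall>x\<in>L. \<forall>y\<in>L. x + y \<in> L) \<and>
     (\<forall>c. \<forall>x\<in>L. c *\<^sub>C x \<in> L) \<and> (\<forall>b. \<forall>x\<in>L. b * x \<in> L)"

definition maximal_left_ideal :: "'a::complex_banach_algebra_1 set \<Rightarrow> bool" where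
  "maximal_left_ideal L \<longleftrightarrow> left_ideal L \<and> L \<noteq> UNIV \<and>
     (\<forall>K. left_ideal K \<and> L \<subseteq> K \<and> K \<noteq> UNIV \<longrightarrow> K = L)"

definition jacobson_radical :: "'a::complex_banach_algebra_1 set" where
  "jacobson_radical = \<Inter> {L. maximal_left_ideal L}"

definition semisimple :: "'a::complex_banach_algebra_1 itself \<Rightarrow> bool" where
  "semisimple _ \<longleftrightarrow> jacobson_radical = ({0} :: 'a set)"

definition minimal_left_ideal :: "'a::complex_banach_algebra_1 set \<Rightarrow> bool" where
  "minimal_left_ideal L \<longleftrightarrow> left_ideal L \<and> L \<noteq> {0} \<and>
     (\<forall>K. left_ideal K \<and> K \<subseteq> L \<longrightarrow> K = {0} \<or> K = L)"

text \<open>The socle: the sum of all minimal left ideals (finite sums of elements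
of minimal left ideals; it is {0} if there is no minimal left ideal).\<close>
inductive_set socle :: "'a::complex_banach_algebra_1 set" where
  socle_zero: "0 \<in> socle"
| socle_add: "minimal_left_ideal L \<Longrightarrow> x \<in> L \<Longrightarrow> s \<in> socle \<Longrightarrow> x + s \<in> socle"

definition invertible_el :: "'a::complex_banach_algebra_1 \<Rightarrow> bool" where
  "invertible_el x \<longleftrightarrow> (\<exists>y. x * y = 1 \<and> y * x = 1)"

definition ainv :: "'a::complex_banach_algebra_1 \<Rightarrow> 'a" where
  "ainv x = (THE y. x * y = 1 \<and> y * x = 1)"

definition alg_spectrum :: "'a::complex_banach_algebra_1 \<Rightarrow> complex set" where
  "alg_spectrum x = {\<mu>. \<not> invertible_el (\<mu> *\<^sub>C 1 - x)}"

text \<open>Riesz projection of x at an isolated spectral point l: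
  (1/(2 pi i)) times the contour integral of (mu e - x)^(-1) over the positively
  oriented circle mu(t) = l + r exp(2 pi i t), t in [0,1], where r > 0 is chosen so
  that the closed disc of radius r about l meets the spectrum only in l.
  Since mu'(t) = 2 pi i r exp(2 pi i t), this equals the integral below.\<close>
definition riesz_radius :: "'a::complex_banach_algebra_1 \<Rightarrow> complex \<Rightarrow> real" where
  "riesz_radius x l = (SOME r. r > 0 \<and> cball l r \<inter> alg_spectrum x = {l})"

definition riesz_proj :: "'a::complex_banach_algebra_1 \<Rightarrow> complex \<Rightarrow> 'a" where
  "riesz_proj x l =
     (let r = riesz_radius x l in
      integral {0..1::real}
        (\<lambda>t. (complex_of_real r * exp (2 * pi * \<i> * complex_of_real t)) *\<^sub>C
             ainv ((l + complex_of_real r * exp (2 * pi * \<i> * complex_of_real t)) *\<^sub>C 1 - x)))"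

definition ecard :: "'b set \<Rightarrow> enat" where
  "ecard S = (if finite S then enat (card S) else \<infinity>)"

definition alg_rank :: "'a::complex_banach_algebra_1 \<Rightarrow> enat" where
  "alg_rank u = (SUP y. ecard (alg_spectrum (y * u) - {0}))"

text \<open>Algebraic multiplicity (used for l \<noteq> 0 only; the l = 0 term of the trace
vanishes anyway).\<close>
definition alg_mult :: "complex \<Rightarrow> 'a::complex_banach_algebra_1 \<Rightarrow> nat" where
  "alg_mult l x = the_enat (alg_rank (riesz_proj x l))"

definition soc_trace :: "'a::complex_banach_algebra_1 \<Rightarrow> complex" where
  "soc_trace x = (\<Sum>l\<in>alg_spectrum x. of_nat (alg_mult l x) * l)"

text \<open>pi(b) is the Drazin inverse of pi(a) in A/J (written out in A):
  with some k >= 1.\<close>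
definition drazin_inv_mod :: "'a::complex_banach_algebra_1 set \<Rightarrow> 'a \<Rightarrow> 'a \<Rightarrow> bool" where
  "drazin_inv_mod J a b \<longleftrightarrow>
     a * b - b * a \<in> J \<and> b * a * b - b \<in> J \<and>
     (\<exists>k\<ge>1. a ^ k * b * a - a ^ k \<in> J)"

definition B_fredholm_mod :: "'a::complex_banach_algebra_1 set \<Rightarrow> 'a \<Rightarrow> bool" where
  "B_fredholm_mod J a \<longleftrightarrow> (\<exists>b. drazin_inv_mod J a b)"

definition fredholm_mod :: "'a::complex_banach_algebra_1 set \<Rightarrow> 'a \<Rightarrow> bool" where
  "fredholm_mod J a \<longleftrightarrow> (\<exists>b. a * b - 1 \<in> J \<and> b * a - 1 \<in> J)"

text \<open>Index: tau(a a0 - a0 a) for any a0 with pi(a0) the Drazin inverse of pi(a)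
(for Fredholm a this is the inverse of pi(a)).\<close>
definition bf_index :: "'a::complex_banach_algebra_1 set \<Rightarrow> 'a \<Rightarrow> complex" where
  "bf_index J a = (let a0 = (SOME b. drazin_inv_mod J a b) in soc_trace (a * a0 - a0 * a))"

end

theory Submission
  imports Defs
begin

text \<open>In a semi-simple algebra every minimal left ideal is $Ap$ with $pAp = \mathbb{C}p$ (Gelfand--Mazur),
and a Gram--Schmidt argument places every $x$ in the socle in some $Aq$ with $q = e_1 + \dots + e_n$
a sum of orthogonal minimal idempotents.  Then $T(x) = \sum_k c_k$, where $e_k x e_k = c_k e_k$, does not
depend on $q$; it is linear, it satisfies $T(xy) = T(yx)$, it vanishes on nilpotents, and it equals
$n$ on $q$ itself.  Splitting $x$ along its Riesz projections, whose rank is their $T$-value,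
identifies it with the spectral trace.

For the index only the ideal $J$ and the tracial functional $T$ matter.  On pairs commuting modulo $J$,
$\omega(x,y) = T(xy - yx)$ depends on the classes alone, is alternating, and satisfies
$\omega(xy,z) + \omega(yz,x) + \omega(zx,y) = 0$; hence $\omega(g,e) = 0$ for $e$ idempotent modulo $J$.
If $b$ is a Drazin inverse of $a$ modulo $J$, an inverse of $a - \lambda$ is
$br - \sum_{i<k} \lambda^{-i-1} a^i (1 - ab)$ with $r = (1 - \lambda b)^{-1}$, and the cocycle identity
reduces its index $\omega(a, br)$ to $\omega(a,b)$.\<close>

section \<open>Resolvents of affine families\<close>

text \<open>The socle need not be closed, so \<open>A/J\<close> carries no Banach algebra structure
  in which to perturb. All computations take place in \<open>A\<close>, with congruences modulo
  \<open>J\<close>; the only infinite series, that of \<open>(1 - l b)^(-1)\<close>, is summed in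
  \<open>A\<close> for one fixed lift \<open>b\<close>, which is where the bound on \<open>l\<close>
  comes from.

  The spectral trace is built from contour integrals and a supremum of cardinalities, so neither its
  additivity nor its vanishing on commutators is visible. Counting along minimal idempotents gives
  both, from the single identity \<open>coef_swap\<close>. The analysis needed to return to Riesz
  projections is the mean value property of the inverse of \<open>u + z v\<close>; in a corner
  \<open>qAq\<close> the same property gives Gelfand's nonempty spectrum.

  Semi-simplicity enters in two ways: minimal left ideals are generated by idempotents, and
  \<open>u A u = 0\<close> forces \<open>u = 0\<close>. The latter makes finite-rank elements von
  Neumann regular, and regularity does the work that bases and complements do for matrices.\<close>

lemma bounded_bilinear_cscale: "bounded_bilinear (\<lambda>c (x::'a::complex_banach_algebra_1). c *\<^sub>C x)"
proof
  fix a b :: complex and x y :: 'a and r :: real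
  show "(a + b) *\<^sub>C x = a *\<^sub>C x + b *\<^sub>C x" by (rule cscale_add_left)
  show "a *\<^sub>C (x + y) = a *\<^sub>C x + a *\<^sub>C y" by (rule cscale_add_right)
  show "(r *\<^sub>R a) *\<^sub>C x = r *\<^sub>R (a *\<^sub>C x)"
    by (metis cscale_cscale cscale_of_real scaleR_conv_of_real)
  show "a *\<^sub>C (r *\<^sub>R x) = r *\<^sub>R (a *\<^sub>C x)"
    by (metis cscale_cscale cscale_of_real mult.commute)
  show "\<exists>K. \<forall>(a::complex) (x::'a). norm (a *\<^sub>C x) \<le> norm a * norm x * K"
    by (rule exI[of _ 1]) (simp add: norm_cscale)
qed

interpretation cs: bounded_bilinear "\<lambda>c (x::'a::complex_banach_algebra_1). c *\<^sub>C x"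
  by (rule bounded_bilinear_cscale)

declare cs.zero_left [simp] cs.zero_right [simp]

lemmas cscale_simps =
  cs.minus_left cs.minus_right cscale_cscale cscale_one
  cscale_mult_left cscale_mult_right

lemmas cscale_algebra = algebra_simps cs.diff_left cs.diff_right cs.add_left cs.add_right cscale_simps

lemma cscale_eq_0_iff [simp]: "c *\<^sub>C (x::'a::complex_banach_algebra_1) = 0 \<longleftrightarrow> c = 0 \<or> x = 0"
  using norm_cscale[of c x] by (metis mult_eq_0_iff norm_eq_zero)

lemma cscale_left_cancel: "c *\<^sub>C (x::'a::complex_banach_algebra_1) = d *\<^sub>C x \<Longrightarrow> x \<noteq> 0 \<Longrightarrow> c = d"
  by (metis cs.diff_left cscale_eq_0_iff eq_iff_diff_eq_0)

lemma ainv_eqI: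
  fixes x :: "'a::complex_banach_algebra_1"
  assumes "x * y = 1" "y * x = 1"
  shows "ainv x = y"
  unfolding ainv_def
proof (rule the_equality)
  fix z assume "x * z = 1 \<and> z * x = 1"
  then show "z = y" by (metis assms(1) mult.assoc mult_1_left mult_1_right)
qed (use assms in simp)

lemma invertible_elI: "x * y = 1 \<Longrightarrow> y * x = 1 \<Longrightarrow> invertible_el x"
  unfolding invertible_el_def by blast

lemma ainv_inverse:
  assumes "invertible_el x"
  shows "x * ainv x = 1" "ainv x * x = 1"
  using assms ainv_eqI unfolding invertible_el_def by force+

lemma ainv_diff:
  assumes "invertible_el x" "invertible_el y"
  shows "ainv x - ainv y = ainv x * (y - x) * ainv y"
proof -
  have "ainv x * (y - x) * ainv y = ainv x * (y * ainv y) - (ainv x * x) * ainv y"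
    by (simp add: algebra_simps)
  then show ?thesis by (simp add: ainv_inverse assms)
qed

text \<open>The resolvent identity bounds \<open>K z - K w\<close> by a multiple of
  \<open>norm (K z)\<close>, itself not yet controlled. Near \<open>w\<close> the factor is at most
  1/2, so \<open>norm (K z)\<close> is at most \<open>2 * norm (K w)\<close>, and the bound becomes
  linear in \<open>cmod (z - w)\<close>.\<close>

lemma ainv_affine_continuous:
  fixes u v :: "'a::complex_banach_algebra_1"
  assumes inv: "\<And>z. z \<in> S \<Longrightarrow> invertible_el (u + z *\<^sub>C v)" and w: "w \<in> S"
  shows "((\<lambda>z. ainv (u + z *\<^sub>C v)) \<longlongrightarrow> ainv (u + w *\<^sub>C v)) (at w within S)"
proof -
  define K where "K z = ainv (u + z *\<^sub>C v)" for z
  define M where "M = norm v * norm (K w) + 1"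
  have M: "M > 0" unfolding M_def by (meson add_nonneg_pos mult_nonneg_nonneg norm_ge_zero zero_less_one)
  have d: "K z - K w = (w - z) *\<^sub>C (K z * v * K w)" if "z \<in> S" for z
    using ainv_diff[OF inv[OF that] inv[OF w]] unfolding K_def
    by (simp add: cscale_simps cs.diff_left[symmetric])
  have b: "norm (K z - K w) \<le> cmod (z - w) * norm (K z) * M" if "z \<in> S" for z
  proof -
    have "norm (K z - K w) = cmod (z - w) * norm (K z * v * K w)"
      by (simp add: d that norm_cscale norm_minus_commute)
    also have "norm (K z * v * K w) \<le> norm (K z) * norm v * norm (K w)"
      by (meson norm_mult_ineq mult_right_mono norm_ge_zero order_trans)
    also have "\<dots> \<le> norm (K z) * M" unfolding M_def by (simp add: algebra_simps)
    finally show ?thesis by (simp add: mult_left_mono mult.assoc)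
  qed
  have ev: "\<forall>\<^sub>F z in at w within S. norm (K z - K w) \<le> cmod (z - w) * (2 * norm (K w) * M)"
    unfolding eventually_at
  proof (intro exI[of _ "1/(2*M)"] conjI ballI impI)
    fix z assume z: "z \<in> S" "z \<noteq> w \<and> dist z w < 1/(2*M)"
    have "cmod (z - w) * M \<le> 1/2" using z M by (simp add: dist_norm field_simps)
    then have "norm (K z) * (cmod (z - w) * M) \<le> norm (K z) * (1/2)"
      by (intro mult_left_mono) auto
    then have "norm (K z - K w) \<le> norm (K z) / 2" using b[OF z(1)] by (simp add: algebra_simps)
    then have "norm (K z) \<le> 2 * norm (K w)"
      using norm_triangle_ineq2[of "K z" "K w"] by linarith
    then show "norm (K z - K w) \<le> cmod (z - w) * (2 * norm (K w) * M)"
      using b[OF z(1)] M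
      by (smt (verit, best) mult.assoc mult_left_mono mult_right_mono norm_ge_zero)
  qed (use M in auto)
  have "((\<lambda>z. cmod (z - w) * (2 * norm (K w) * M)) \<longlongrightarrow> 0) (at w within S)"
    by (auto intro!: tendsto_eq_intros)
  then have "((\<lambda>z. K z - K w) \<longlongrightarrow> 0) (at w within S)"
    by (rule Lim_null_comparison[OF ev])
  then show ?thesis unfolding K_def by (rule LIM_zero_cancel)
qed

text \<open>By the resolvent identity the first-order remainder is exactly \<open>z - w\<close>
  times \<open>(K w - K z) * v * K w\<close>, so continuity suffices. The complex derivative is
  phrased as a real one so that it composes with real curves.\<close>

lemma ainv_affine_has_derivative:
  fixes u v :: "'a::complex_banach_algebra_1"
  assumes inv: "\<And>z. z \<in> S \<Longrightarrow> invertible_el (u + z *\<^sub>C v)" and w: "w \<in> S"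
  shows "((\<lambda>z. ainv (u + z *\<^sub>C v)) has_derivative
     (\<lambda>h. h *\<^sub>C (- (ainv (u + w *\<^sub>C v) * v * ainv (u + w *\<^sub>C v))))) (at w within S)"
proof -
  define K where "K z = ainv (u + z *\<^sub>C v)" for z
  have d: "K z - K w = (w - z) *\<^sub>C (K z * v * K w)" if "z \<in> S" for z
    using ainv_diff[OF inv[OF that] inv[OF w]] unfolding K_def
    by (simp add: cscale_simps cs.diff_left[symmetric])
  have "((\<lambda>z. norm ((K w - K z) * v * K w)) \<longlongrightarrow> norm ((K w - K w) * v * K w)) (at w within S)"
    unfolding K_def by (intro tendsto_intros ainv_affine_continuous inv w)
  then have lim: "((\<lambda>z. norm ((K w - K z) * v * K w)) \<longlongrightarrow> 0) (at w within S)" by simp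
  have "(K has_derivative (\<lambda>h. h *\<^sub>C (- (K w * v * K w)))) (at w within S)"
    unfolding has_derivative_iff_norm
  proof (intro conjI)
    show "bounded_linear (\<lambda>h. h *\<^sub>C (- (K w * v * K w)))" by (rule cs.bounded_linear_left)
    have "\<forall>\<^sub>F z in at w within S. norm (K z - K w - (z - w) *\<^sub>C (- (K w * v * K w))) / norm (z - w)
        = norm ((K w - K z) * v * K w)"
      unfolding eventually_at
    proof (intro exI[of _ 1] conjI ballI impI)
      fix z assume z: "z \<in> S" "z \<noteq> w \<and> dist z w < 1"
      have "K z - K w - (z - w) *\<^sub>C (- (K w * v * K w)) = (z - w) *\<^sub>C ((K w - K z) * v * K w)"
        unfolding d[OF z(1)] by (simp add: cscale_algebra)
      then show "norm (K z - K w - (z - w) *\<^sub>C (- (K w * v * K w))) / norm (z - w)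
        = norm ((K w - K z) * v * K w)" using z by (simp add: norm_cscale)
    qed simp
    then show "((\<lambda>z. norm (K z - K w - (z - w) *\<^sub>C (- (K w * v * K w))) / norm (z - w)) \<longlongrightarrow> 0) (at w within S)"
      using lim by (simp add: tendsto_cong)
  qed
  then show ?thesis unfolding K_def .
qed

text \<open>The mean over the circle of radius $s$ is constant in $s$: its derivative in $s$ is, up to a factor, the
integral of the derivative in $t$, over a closed curve.  Both orientations $c = \pm 2\pi i$ are needed below.\<close>

lemma ainv_affine_mean_value:
  fixes u v :: "'a::complex_banach_algebra_1"
  assumes inv: "\<And>z. cmod z \<le> r \<Longrightarrow> invertible_el (u + z *\<^sub>C v)" and r: "r \<ge> 0"
    and c: "exp c = 1" "c \<noteq> 0"
  shows "((\<lambda>t. ainv (u + (of_real r * exp (c * of_real t)) *\<^sub>C v)) has_integral ainv u) {0..1}"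
proof -
  define K where "K z = ainv (u + z *\<^sub>C v)" for z
  define D where "D z = - (K z * v * K z)" for z
  define g where "g s t = of_real s * exp (c * of_real t)" for s t :: real
  have "Re c = 0" using arg_cong[OF c(1), of cmod] by simp
  then have cm: "cmod (exp (c * of_real t)) = 1" for t by simp
  have g_in: "g s t \<in> cball 0 r" if "s \<in> {0..r}" for s t
    using that by (simp add: g_def norm_mult cm del: norm_exp_eq_Re)
  have inv': "invertible_el (u + z *\<^sub>C v)" if "z \<in> cball 0 r" for z using that inv by simp
  have Kder: "(K has_derivative (\<lambda>h. h *\<^sub>C D z)) (at z within cball 0 r)" if "z \<in> cball 0 r" for z
    unfolding K_def D_def by (rule ainv_affine_has_derivative[OF inv' that])
  have Kcont: "continuous_on (cball 0 r) K"
    using Kder has_derivative_continuous unfolding continuous_on_eq_continuous_within by blast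
  have Dcont: "continuous_on (cball 0 r) D"
    unfolding D_def by (intro continuous_intros Kcont)
  have sder: "((\<lambda>s. K (g s t)) has_vector_derivative exp (c * of_real t) *\<^sub>C D (g s t)) (at s within {0..r})"
    if s: "s \<in> {0..r}" for s t
  proof -
    have "((\<lambda>s. g s t) has_derivative (\<lambda>h. of_real h * exp (c * of_real t))) (at s within {0..r})"
      unfolding g_def by (intro derivative_eq_intros | simp)+
    then have "((\<lambda>s. K (g s t)) has_derivative (\<lambda>h. (of_real h * exp (c * of_real t)) *\<^sub>C D (g s t)))
        (at s within {0..r})"
      by (rule has_derivative_in_compose2[where t="cball 0 r", rotated 3])
         (use Kder g_in s in auto)
    then show ?thesis unfolding has_vector_derivative_def
      by (simp add: cscale_cscale[symmetric] cscale_of_real)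
  qed
  have tder: "((\<lambda>t. K (g s t)) has_vector_derivative (of_real s * c) *\<^sub>C (exp (c * of_real t) *\<^sub>C D (g s t)))
      (at t within {0..1})" if s: "s \<in> {0..r}" "t \<in> {0..1}" for s t
  proof -
    have "((\<lambda>t. g s t) has_derivative (\<lambda>h. of_real h * (of_real s * (c * exp (c * of_real t))))) (at t within {0..1})"
    proof -
      have "((\<lambda>t. c * complex_of_real t) has_derivative (\<lambda>h. c * of_real h)) (at t within {0..1})"
        by (intro derivative_eq_intros | simp)+
      from has_derivative_compose[OF this has_field_derivative_imp_has_derivative[OF DERIV_exp]]
      have "((\<lambda>t. exp (c * complex_of_real t)) has_derivative
          (\<lambda>h. exp (c * of_real t) * (c * of_real h))) (at t within {0..1})" .
      from has_derivative_mult_right[OF this, of "of_real s"] show ?thesis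
        unfolding g_def by (simp add: mult_ac)
    qed
    then have "((\<lambda>t. K (g s t)) has_derivative
        (\<lambda>h. (of_real h * (of_real s * (c * exp (c * of_real t)))) *\<^sub>C D (g s t))) (at t within {0..1})"
      by (rule has_derivative_in_compose2[where t="cball 0 r", rotated 3])
         (use Kder g_in s in auto)
    then show ?thesis unfolding has_vector_derivative_def
      by (simp add: cscale_cscale cscale_of_real[symmetric] mult.assoc)
  qed
  have gcont: "continuous_on ({0..r} \<times> {0..1}) (\<lambda>x. g (fst x) (snd x))"
    unfolding g_def by (intro continuous_intros)
  have ucont: "continuous_on {0..1} (\<lambda>t. g s t)" for s
    unfolding g_def by (intro continuous_intros)
  have Kg: "continuous_on {0..1} (\<lambda>t. K (g s t))" if "s \<in> {0..r}" for s
    by (rule continuous_on_compose2[OF Kcont ucont]) (use g_in that in auto)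
  have Dg: "continuous_on {0..1} (\<lambda>t. D (g s t))" if "s \<in> {0..r}" for s
    by (rule continuous_on_compose2[OF Dcont ucont]) (use g_in that in auto)
  define I where "I s = integral {0..1} (\<lambda>t. K (g s t))" for s
  define I' where "I' s = integral {0..1} (\<lambda>t. exp (c * of_real t) *\<^sub>C D (g s t))" for s
  have Ider: "(I has_vector_derivative I' s) (at s within {0..r})" if "s \<in> {0..r}" for s
    unfolding I_def I'_def interval_cbox[of "0::real" 1]
  proof (rule leibniz_rule_vector_derivative)
    show "continuous_on ({0..r} \<times> cbox 0 1) (\<lambda>(x, t). exp (c * complex_of_real t) *\<^sub>C D (g x t))"
      unfolding split_beta interval_cbox[of "0::real" 1, symmetric]
      by (intro cs.continuous_on continuous_intros continuous_on_compose2[OF Dcont gcont])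
         (use g_in in auto)
  qed (use that sder integrable_continuous_real[OF Kg] in auto)
  have I'0: "I' s = 0" if s: "s \<in> {0..r}" "s \<noteq> 0" for s
  proof -
    have "((\<lambda>t. (of_real s * c) *\<^sub>C (exp (c * of_real t) *\<^sub>C D (g s t))) has_integral K (g s 1) - K (g s 0)) {0..1}"
      by (rule fundamental_theorem_of_calculus) (use tder s in auto)
    moreover have "((\<lambda>t. (of_real s * c) *\<^sub>C (exp (c * of_real t) *\<^sub>C D (g s t))) has_integral (of_real s * c) *\<^sub>C I' s) {0..1}"
      unfolding I'_def
      by (rule has_integral_linear[OF _ cs.bounded_linear_right, unfolded o_def])
         (intro integrable_integral integrable_continuous_real cs.continuous_on continuous_intros Dg s)
    ultimately have "(of_real s * c) *\<^sub>C I' s = K (g s 1) - K (g s 0)" by (rule has_integral_unique[symmetric])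
    also have "\<dots> = 0" by (simp add: g_def c)
    finally show ?thesis using s c by simp
  qed
  \<comment> \<open>At \<open>s = 0\<close> the factor \<open>s * c\<close> cannot be cancelled, so
    the derivative of \<open>I\<close> is known to vanish only away from 0; continuity of
    \<open>I\<close> covers that point.\<close>
  have "I r = I 0"
  proof (rule has_derivative_zero_unique_strong_interval[of "{0}" 0 r])
    show "continuous_on {0..r} I"
      using Ider has_vector_derivative_continuous unfolding continuous_on_eq_continuous_within by blast
    show "(I has_derivative (\<lambda>h. 0)) (at x within {0..r})" if "x \<in> {0..r} - {0}" for x
      using Ider[of x] I'0[of x] that by (simp add: has_vector_derivative_def)
  qed (use r in auto)
  also have "I 0 = ainv u" by (simp add: I_def g_def K_def)
  finally have "((\<lambda>t. K (g r t)) has_integral ainv u) {0..1}"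
    using integrable_integral[OF integrable_continuous_real[OF Kg[of r]]] r by (simp add: I_def)
  then show ?thesis unfolding K_def g_def .
qed

text \<open>Gelfand's theorem for the algebra \<open>qAq\<close> with unit \<open>q\<close>. The
  mean value property replaces Liouville: the corner inverse at 0 is its own mean over arbitrarily
  large circles, where it tends to 0. Used both for Gelfand--Mazur and for finding
  eigenvalues.\<close>

lemma corner_spectrum_nonempty:
  fixes q y :: "'a::complex_banach_algebra_1"
  assumes q: "q * q = q" "q \<noteq> 0" and y: "q * y = y" "y * q = y"
  shows "\<exists>l. \<not> (\<exists>b. q * b = b \<and> b * q = b \<and> (y - l *\<^sub>C q) * b = q \<and> b * (y - l *\<^sub>C q) = q)"
proof (rule ccontr)
  assume "\<not> ?thesis"
  then obtain B where B: "\<And>l. q * B l = B l" "\<And>l. B l * q = B l"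
    "\<And>l. (y - l *\<^sub>C q) * B l = q" "\<And>l. B l * (y - l *\<^sub>C q) = q"
    by metis
  \<comment> \<open>Adding \<open>1 - q\<close> turns invertibility in the corner into invertibility
    in the whole algebra; multiplying the inverse by \<open>q\<close> undoes this.\<close>
  define u v where "u = y + (1 - q)" and "v = - q"
  define k where "k l = B l + (1 - q)" for l
  have uv: "u + l *\<^sub>C v = (y - l *\<^sub>C q) + (1 - q)" for l unfolding u_def v_def by (simp add: cscale_simps)
  have z: "(y - l *\<^sub>C q) * (1 - q) = 0" "(1 - q) * (y - l *\<^sub>C q) = 0"
     "B l * (1 - q) = 0" "(1 - q) * B l = 0" "(1 - q) * (1 - q) = 1 - q" for l
    using q y B(1,2)[of l] by (simp_all add: cscale_algebra)
  have k1: "(u + l *\<^sub>C v) * k l = 1" for l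
  proof -
    have "(u + l *\<^sub>C v) * k l = (y - l *\<^sub>C q) * B l + (y - l *\<^sub>C q) * (1 - q)
       + ((1 - q) * B l + (1 - q) * (1 - q))"
      unfolding uv k_def by (simp only: distrib_left distrib_right add_ac)
    then show ?thesis using B(3)[of l] z by simp
  qed
  have k2: "k l * (u + l *\<^sub>C v) = 1" for l
  proof -
    have "k l * (u + l *\<^sub>C v) = B l * (y - l *\<^sub>C q) + (1 - q) * (y - l *\<^sub>C q)
       + (B l * (1 - q) + (1 - q) * (1 - q))"
      unfolding uv k_def by (simp only: distrib_left distrib_right add_ac)
    then show ?thesis using B(4)[of l] z by simp
  qed
  have inv: "invertible_el (u + l *\<^sub>C v)" for l using invertible_elI k1 k2 by blast
  have ainv: "ainv (u + l *\<^sub>C v) = k l" for l using ainv_eqI k1 k2 by blast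
  have kq: "k l * q = B l" for l using q B unfolding k_def by (simp add: algebra_simps)
  define c where "c = 2 * of_real pi * \<i>"
  have c: "exp c = 1" "c \<noteq> 0" "Re c = 0" unfolding c_def by (simp_all add: exp_eq_polar)
  have mean: "((\<lambda>t. B (of_real r * exp (c * of_real t))) has_integral B 0) {0..1}" if "r \<ge> 0" for r
  proof -
    have "((\<lambda>t. ainv (u + (of_real r * exp (c * of_real t)) *\<^sub>C v) * q) has_integral ainv u * q) {0..1}"
      by (rule has_integral_linear[OF _ bounded_linear_mult_left, unfolded o_def],
          rule ainv_affine_mean_value) (use inv that c in auto)
    moreover have "ainv u = k 0" using ainv[of 0] by simp
    ultimately show ?thesis by (simp add: ainv kq)
  qed
  have bound: "norm (B l) * (cmod l - norm y) \<le> norm q" for l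
  proof -
    have "l *\<^sub>C B l = y * B l - q" using B(3)[of l] B(1)[of l] by (simp add: cscale_algebra)
    then have "cmod l * norm (B l) = norm (y * B l - q)" by (metis norm_cscale)
    also have "\<dots> \<le> norm y * norm (B l) + norm q"
      by (meson add_mono_thms_linordered_semiring(3) norm_mult_ineq norm_triangle_ineq4 order_trans)
    finally show ?thesis by (simp add: algebra_simps)
  qed
  have "norm (B 0) \<le> e" if "e > 0" for e
  proof -
    \<comment> \<open>Chosen so that \<open>norm q \<le> e * (r - norm y)\<close>; then
      \<open>bound\<close> gives norm at most \<open>e\<close> on the whole circle.\<close>
    define r where "r = norm y + norm q / e + 1"
    have r: "r - norm y > 0" "norm q \<le> e * (r - norm y)" "r \<ge> 0"
      using that unfolding r_def by (simp_all add: field_simps add_pos_nonneg)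
    have bd: "norm (B (of_real r * exp (c * of_real t))) \<le> e" for t
    proof -
      let ?z = "of_real r * exp (c * of_real t)"
      have z: "cmod ?z = r" using r c(3) by (simp add: norm_mult)
      have "norm (B ?z) * (r - norm y) \<le> e * (r - norm y)" 
        using bound[of ?z] r(2) unfolding z by linarith
      from mult_right_le_imp_le[OF this r(1)] show ?thesis .
    qed
    have "norm (integral {0..1} (\<lambda>t. B (of_real r * exp (c * of_real t)))) \<le> integral {0..1::real} (\<lambda>t. e)"
      by (rule integral_norm_bound_integral) (use mean[OF r(3)] bd in auto)
    then show ?thesis using integral_unique[OF mean[OF r(3)]] by simp
  qed
  then have "norm (B 0) \<le> 0" by (meson dense not_le order_less_imp_le field_le_epsilon add_0)
  then have "B 0 = 0" by simp
  then show False using B(3)[of 0] q by simp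
qed

section \<open>Riesz projections\<close>

lemma invertible_el_one_minus_nilpotent:
  fixes z :: "'a::complex_banach_algebra_1"
  assumes "z ^ n = 0"
  shows "invertible_el (1 - z)"
proof -
  have "\<exists>s. (1 - z) * s = 1 - z ^ n \<and> s * (1 - z) = 1 - z ^ n"
  proof (induction n)
    case (Suc n)
    then obtain s where s: "(1 - z) * s = 1 - z ^ n" "s * (1 - z) = 1 - z ^ n" by blast
    have "(1 - z) * (s + z ^ n) = 1 - z ^ Suc n" "(s + z ^ n) * (1 - z) = 1 - z ^ Suc n"
      unfolding distrib_left distrib_right s by (simp_all add: algebra_simps power_commutes)
    then show ?case by blast
  qed (auto intro: exI[of _ 0])
  then show ?thesis using assms invertible_elI by auto
qed

text \<open>$Q$ is the spectral idempotent of $x$ at $l$; it is $0$ when $l$ lies outside the spectrum.\<close>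

definition fitting :: "'a::complex_banach_algebra_1 \<Rightarrow> complex \<Rightarrow> 'a \<Rightarrow> bool" where
  "fitting x l Q \<longleftrightarrow> Q * Q = Q \<and> (\<forall>z. z * x = x * z \<longrightarrow> z * Q = Q * z) \<and>
     (\<exists>n. (x - l *\<^sub>C 1) ^ n * Q = 0) \<and>
     (\<exists>w. (x - l *\<^sub>C 1) * w = 1 - Q \<and> w * (x - l *\<^sub>C 1) = 1 - Q)"

lemma alg_spectrum_iff: "l \<in> alg_spectrum x \<longleftrightarrow> \<not> invertible_el (x - l *\<^sub>C 1)"
proof -
  have "invertible_el (- y)" if "invertible_el y" for y :: 'a
    using that unfolding invertible_el_def by (metis minus_mult_minus)
  from this[of "x - l *\<^sub>C 1"] this[of "l *\<^sub>C 1 - x"] show ?thesis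
    unfolding alg_spectrum_def by auto
qed

lemma inverse_commute:
  fixes x :: "'a::complex_banach_algebra_1"
  assumes "x * y = 1" "y * x = 1" "z * x = x * z"
  shows "z * y = y * z"
  by (metis assms mult.assoc mult_1_left mult_1_right)

text \<open>The exponent starts at 1: at exponent 0 one side would be 1 and the other
  \<open>Q\<close>.\<close>

lemma power_times_idempotent:
  fixes x :: "'a::complex_banach_algebra_1"
  assumes "Q * Q = Q" "x * Q = Q * x"
  shows "(x * Q) ^ Suc n = x ^ Suc n * Q"
proof (induction n)
  case (Suc n)
  have "(x * Q) ^ Suc (Suc n) = x * Q * (x ^ Suc n * Q)" using Suc by simp
  also have "\<dots> = x * (Q * x ^ Suc n) * Q" by (simp add: mult.assoc)
  also have "Q * x ^ Suc n = x ^ Suc n * Q" using assms(2) by (metis power_commuting_commutes)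
  finally show ?case using assms by (simp add: mult.assoc)
qed simp

lemma fitting_idem: "fitting x l Q \<Longrightarrow> Q * Q = Q"
  unfolding fitting_def by blast

lemma fitting_commute: "fitting x l Q \<Longrightarrow> x * Q = Q * x"
  unfolding fitting_def by auto

text \<open>If \<open>x - l\<close> is invertible, the power of it that kills \<open>Q\<close> can
  be cancelled; conversely, for \<open>Q = 0\<close> the partial inverse \<open>w\<close> is an
  inverse.\<close>

lemma fitting_eq_0_iff:
  assumes "fitting x l Q"
  shows "Q = 0 \<longleftrightarrow> l \<notin> alg_spectrum x"
proof
  assume "Q = 0"
  then show "l \<notin> alg_spectrum x"
    using assms invertible_elI unfolding fitting_def alg_spectrum_iff by fastforce
next
  assume "l \<notin> alg_spectrum x"
  then obtain b where b: "b * (x - l *\<^sub>C 1) = 1"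
    unfolding alg_spectrum_iff invertible_el_def by blast
  obtain n where n: "(x - l *\<^sub>C 1) ^ n * Q = 0" using assms unfolding fitting_def by blast
  have "b ^ n * (x - l *\<^sub>C 1) ^ n = 1"
  proof (induction n)
    case (Suc n)
    have "b ^ Suc n * (x - l *\<^sub>C 1) ^ Suc n = b ^ n * (b * (x - l *\<^sub>C 1)) * (x - l *\<^sub>C 1) ^ n"
      by (simp only: power_Suc2 power_Suc mult.assoc) (simp only: mult.assoc[symmetric] power_commutes)
    then show ?case using Suc b by simp
  qed simp
  then show "Q = 0" using n by (metis mult.assoc mult_1_left mult_zero_right)
qed

text \<open>With $N = (x - l)Q$, the integrand $z (z - (x - l))^{-1}$ is $(1 - z^{-1} N)^{-1}$ plus a term affine in the inverse of
$Q - (x-l)(1-Q) + z(1-Q)$; the mean value lemma, in the variable $1/z$ and in $z$, evaluates both.\<close>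

lemma riesz_proj_eq:
  fixes x :: "'a::complex_banach_algebra_1"
  assumes fin: "finite (alg_spectrum x)" and l: "l \<in> alg_spectrum x" and fit: "fitting x l Q"
  shows "riesz_proj x l = Q"
proof -
  define r where "r = riesz_radius x l"
  have r: "r > 0" "cball l r \<inter> alg_spectrum x = {l}"
  proof -
    obtain d where d: "d > 0" "\<forall>m\<in>alg_spectrum x. m \<noteq> l \<longrightarrow> d \<le> dist l m"
      using finite_set_avoid[OF fin, of l] by blast
    have "d / 2 > 0 \<and> cball l (d/2) \<inter> alg_spectrum x = {l}" using d l by fastforce
    then have "\<exists>r. r > 0 \<and> cball l r \<inter> alg_spectrum x = {l}" by blast
    from someI_ex[OF this] show "r > 0" "cball l r \<inter> alg_spectrum x = {l}"
      unfolding r_def riesz_radius_def by auto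
  qed
  define c where "c = 2 * of_real pi * \<i>"
  have c: "exp c = 1" "c \<noteq> 0" "Re c = 0"
    unfolding c_def by (simp_all add: exp_eq_polar)
  then have c': "exp (- c) = 1" by (simp add: exp_minus)
  define y where "y = x - l *\<^sub>C 1"
  obtain n w where Q: "Q * Q = Q" "y ^ n * Q = 0" "y * w = 1 - Q" "w * y = 1 - Q" "Q * x = x * Q"
    using fit unfolding fitting_def y_def by metis
  have Qy: "Q * y = y * Q" using Q(5) unfolding y_def by (simp add: cscale_algebra)
  \<comment> \<open>The family \<open>u + z v\<close> is \<open>z - y\<close> on the complement of
    \<open>Q\<close> and the identity on \<open>Q\<close>, so its inverse has no singularity at
    \<open>z = 0\<close>.\<close>
  define u v where "u = Q - y * (1 - Q)" and "v = 1 - Q"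
  define R where "R z = ainv ((l + z) *\<^sub>C 1 - x)" for z
  have R: "(z *\<^sub>C 1 - y) * R z = 1" "R z * (z *\<^sub>C 1 - y) = 1" if z: "z \<noteq> 0" "cmod z \<le> r" for z
  proof -
    have "l + z \<in> cball l r" "l + z \<noteq> l" using z by (auto simp: dist_norm)
    then have "l + z \<notin> alg_spectrum x" using r(2) by blast
    then have "invertible_el ((l + z) *\<^sub>C 1 - x)" unfolding alg_spectrum_def by blast
    moreover have "(l + z) *\<^sub>C 1 - x = z *\<^sub>C 1 - y" unfolding y_def by (simp add: cscale_algebra)
    ultimately show "(z *\<^sub>C 1 - y) * R z = 1" "R z * (z *\<^sub>C 1 - y) = 1"
      unfolding R_def using ainv_inverse by metis+
  qed
  have RQ: "Q * R z = R z * Q" if z: "z \<noteq> 0" "cmod z \<le> r" for z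
    by (rule inverse_commute[OF R[OF z]]) (simp add: cscale_algebra Qy)
  have yR: "y * R z = z *\<^sub>C R z - 1" "R z * y = z *\<^sub>C R z - 1" if z: "z \<noteq> 0" "cmod z \<le> r" for z
    using R[OF z] by (simp_all add: cscale_algebra)
  have K1: "(u + z *\<^sub>C v) * (R z * (1 - Q) + Q) = 1"
    and K2: "(R z * (1 - Q) + Q) * (u + z *\<^sub>C v) = 1" if z: "z \<noteq> 0" "cmod z \<le> r" for z
  proof -
    have e: "u + z *\<^sub>C v = (z *\<^sub>C 1 - y) * (1 - Q) + Q" unfolding u_def v_def by (simp add: cscale_algebra)
    have o: "(1 - Q) * Q = 0" "Q * (1 - Q) = 0" "(1 - Q) * (1 - Q) = 1 - Q"
      using Q by (simp_all add: algebra_simps)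
    have k: "(1 - Q) * R z = R z * (1 - Q)" "(1 - Q) * (z *\<^sub>C 1 - y) = (z *\<^sub>C 1 - y) * (1 - Q)"
      "Q * (z *\<^sub>C 1 - y) = (z *\<^sub>C 1 - y) * Q"
      using RQ[OF z] Qy by (simp_all add: cscale_algebra)
    have "(u + z *\<^sub>C v) * (R z * (1 - Q) + Q) = (z *\<^sub>C 1 - y) * ((1 - Q) * R z) * (1 - Q)
        + (z *\<^sub>C 1 - y) * ((1 - Q) * Q) + (Q * R z) * (1 - Q) + Q * Q"
      unfolding e by (simp only: distrib_left distrib_right mult.assoc add_ac)
    also have "\<dots> = ((z *\<^sub>C 1 - y) * R z) * ((1 - Q) * (1 - Q)) + R z * (Q * (1 - Q)) + Q"
      unfolding k RQ[OF z] o Q(1) by (simp add: mult.assoc o)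
    finally show "(u + z *\<^sub>C v) * (R z * (1 - Q) + Q) = 1" using o R[OF z] by simp
    have "(R z * (1 - Q) + Q) * (u + z *\<^sub>C v) = R z * ((1 - Q) * (z *\<^sub>C 1 - y)) * (1 - Q)
        + R z * ((1 - Q) * Q) + (Q * (z *\<^sub>C 1 - y)) * (1 - Q) + Q * Q"
      unfolding e by (simp only: distrib_left distrib_right mult.assoc add_ac)
    also have "\<dots> = (R z * (z *\<^sub>C 1 - y)) * ((1 - Q) * (1 - Q)) + (z *\<^sub>C 1 - y) * (Q * (1 - Q)) + Q"
      unfolding k o Q(1) by (simp only: mult.assoc o) simp
    finally show "(R z * (1 - Q) + Q) * (u + z *\<^sub>C v) = 1" using o R[OF z] by simp
  qed
  \<comment> \<open>At \<open>z = 0\<close> no resolvent is available; the partial inverse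
    \<open>w\<close> of \<open>y\<close> takes its place, with a minus sign because
    \<open>z - y\<close> has become \<open>- y\<close>.\<close>
  have u0: "invertible_el u"
  proof (rule invertible_elI)
    have yw: "y * w * (1 - Q) = 1 - Q" "(1 - Q) * (w * y) = 1 - Q"
      unfolding Q(3,4) using Q(1) by (simp_all add: algebra_simps)
    have k: "(1 - Q) * y = y * (1 - Q)" "(1 - Q) * (1 - Q) = 1 - Q" "(1 - Q) * Q = 0" "Q * (1 - Q) = 0"
      using Qy Q(1) by (simp_all add: algebra_simps)
    have "u * (Q - (1 - Q) * w * (1 - Q)) = Q * Q - (Q * (1 - Q)) * w * (1 - Q) - y * ((1 - Q) * Q)
        + y * ((1 - Q) * (1 - Q)) * w * (1 - Q)"
      unfolding u_def by (simp only: left_diff_distrib right_diff_distrib mult.assoc) simp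
    also have "\<dots> = Q + (1 - Q) * (y * w * (1 - Q))" unfolding k Q(1) by (simp add: mult.assoc k(1)[symmetric])
    finally show "u * (Q - (1 - Q) * w * (1 - Q)) = 1" unfolding yw k by simp
    have "(Q - (1 - Q) * w * (1 - Q)) * u = Q * Q - (1 - Q) * w * ((1 - Q) * Q) - Q * y * (1 - Q)
        + (1 - Q) * w * ((1 - Q) * y) * (1 - Q)"
      unfolding u_def by (simp only: left_diff_distrib right_diff_distrib mult.assoc) simp
    also have "\<dots> = Q - y * (Q * (1 - Q)) + ((1 - Q) * (w * y)) * ((1 - Q) * (1 - Q))"
      unfolding k Q(1) Qy by (simp add: mult.assoc k)
    finally show "(Q - (1 - Q) * w * (1 - Q)) * u = 1" unfolding yw k by simp
  qed
  have invK: "invertible_el (u + z *\<^sub>C v)" if "cmod z \<le> r" for z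
    using u0 K1[OF _ that] K2[OF _ that] invertible_elI by (cases "z = 0") auto
  define N where "N = y * Q"
  have invN: "invertible_el (1 + z *\<^sub>C (- N))" for z
  proof -
    have "N ^ Suc n = 0"
      unfolding N_def power_times_idempotent[OF Q(1) Qy[symmetric]] by (simp add: mult.assoc Q(2))
    moreover have "(z *\<^sub>C N) ^ k = z ^ k *\<^sub>C N ^ k" for k by (induction k) (simp_all add: cscale_simps mult.commute)
    ultimately show ?thesis using invertible_el_one_minus_nilpotent[of "z *\<^sub>C N" "Suc n"]
      by (simp add: cscale_simps)
  qed
  \<comment> \<open>The part \<open>z R(z) Q\<close> is the inverse of \<open>1 - N/z\<close> minus
    \<open>1 - Q\<close>. The part \<open>z R(z) (1 - Q)\<close> has a factor \<open>z\<close> that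
    the mean value lemma does not admit; it is rewritten as 1 minus an inverse times the constant
    \<open>u\<close>.\<close>
  have integrand: "z *\<^sub>C R z = ainv (1 + inverse z *\<^sub>C (- N)) + Q - ainv (u + z *\<^sub>C v) * u"
    if z: "z \<noteq> 0" "cmod z \<le> r" for z
  proof -
    have "ainv (1 + inverse z *\<^sub>C (- N)) = z *\<^sub>C (R z * Q) + (1 - Q)"
    proof (rule ainv_eqI)
      have "N * (R z * Q) = y * (Q * R z) * Q" "R z * Q * N = R z * (Q * y) * Q"
        unfolding N_def by (simp_all add: mult.assoc)
      then have "N * (R z * Q) = (y * R z) * (Q * Q)" "R z * Q * N = (R z * y) * (Q * Q)"
        unfolding RQ[OF z] Qy by (simp_all add: mult.assoc)
      then have N: "N * (R z * Q) = z *\<^sub>C (R z * Q) - Q" "R z * Q * N = z *\<^sub>C (R z * Q) - Q"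
        unfolding yR[OF z] Q(1) by (simp_all add: cscale_algebra)
      have NQ: "N * Q = N" "Q * N = N"
        unfolding N_def by (simp_all add: mult.assoc[symmetric] Qy) (simp_all add: mult.assoc Q(1))
      have "inverse z * (z * z) = z" using z by simp
      then have "(inverse z * (z * z)) *\<^sub>C b = z *\<^sub>C b" for b :: 'a by (rule arg_cong)
      then show "(1 + inverse z *\<^sub>C - N) * (z *\<^sub>C (R z * Q) + (1 - Q)) = 1"
        "(z *\<^sub>C (R z * Q) + (1 - Q)) * (1 + inverse z *\<^sub>C - N) = 1"
        using z N NQ by (simp_all add: distrib_left distrib_right left_diff_distrib right_diff_distrib cscale_simps cs.diff_right)
    qed
    moreover have "ainv (u + z *\<^sub>C v) * u = 1 - z *\<^sub>C (R z * (1 - Q))"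
    proof -
      have e: "ainv (u + z *\<^sub>C v) = R z * (1 - Q) + Q" using ainv_eqI K1[OF z] K2[OF z] by blast
      have "(R z * (1 - Q) + Q) * v = R z * (1 - Q)"
        unfolding v_def using Q(1) by (simp add: algebra_simps)
      then show ?thesis unfolding e using K2[OF z] by (simp add: cscale_simps distrib_left eq_diff_eq)
    qed
    ultimately show ?thesis by (simp add: cscale_algebra)
  qed
  \<comment> \<open>While \<open>z\<close> runs through the circle of radius \<open>r\<close>,
    \<open>1/z\<close> runs backwards through that of radius \<open>1/r\<close>, hence the exponent
    \<open>- c\<close>. Both means are values at the centre, leaving
    \<open>1 + Q - 1\<close>.\<close>
  have "((\<lambda>t. ainv (1 + (of_real (1/r) * exp (- c * of_real t)) *\<^sub>C (- N)) + Q
      - ainv (u + (of_real r * exp (c * of_real t)) *\<^sub>C v) * u) has_integral ainv 1 + Q - ainv u * u) {0..1}"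
  proof (intro has_integral_diff has_integral_add)
    show "((\<lambda>t. ainv (1 + (complex_of_real (1 / r) * exp (- c * complex_of_real t)) *\<^sub>C - N)) has_integral
        ainv 1) {0..1}"
      using ainv_affine_mean_value[of "1/r" 1 "- N" "- c"] invN r(1) c c' by simp
    show "((\<lambda>t. Q) has_integral Q) {0..1::real}" using has_integral_const_real[of Q 0 1] by simp
    show "((\<lambda>t. ainv (u + (complex_of_real r * exp (c * complex_of_real t)) *\<^sub>C v) * u) has_integral
        ainv u * u) {0..1}"
      by (rule has_integral_linear[OF _ bounded_linear_mult_left, unfolded o_def],
          rule ainv_affine_mean_value) (use invK r c in auto)
  qed
  moreover have "ainv 1 + Q - ainv u * u = Q"
    using ainv_eqI[of 1 1] ainv_inverse[OF u0] by simp
  moreover have "ainv (1 + (of_real (1/r) * exp (- c * of_real t)) *\<^sub>C (- N)) + Q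
      - ainv (u + (of_real r * exp (c * of_real t)) *\<^sub>C v) * u
      = (of_real r * exp (c * of_real t)) *\<^sub>C R (of_real r * exp (c * of_real t))" for t
    by (subst integrand) (use r(1) c(3) in \<open>auto simp: norm_mult exp_minus field_simps\<close>)
  ultimately have "integral {0..1} (\<lambda>t. (of_real r * exp (c * of_real t)) *\<^sub>C R (of_real r * exp (c * of_real t))) = Q"
    by (simp add: integral_unique)
  then show ?thesis unfolding riesz_proj_def Let_def r_def[symmetric] R_def c_def
    by (simp add: mult.assoc mult.left_commute)
qed

section \<open>Orthogonal minimal idempotents and the finite-rank trace\<close>

definition minidem :: "'a::complex_banach_algebra_1 \<Rightarrow> bool" where
  "minidem p \<longleftrightarrow> p * p = p \<and> p \<noteq> 0 \<and> (\<forall>a. \<exists>c. p * a * p = c *\<^sub>C p)"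

text \<open>For a rank-one projection of a vector space this is the trace of
  \<open>p * a * p\<close>. The description is unique because \<open>p\<close> is nonzero.\<close>

definition coef :: "'a::complex_banach_algebra_1 \<Rightarrow> 'a \<Rightarrow> complex" where
  "coef p a = (THE c. p * a * p = c *\<^sub>C p)"

lemma coef_eqI: "minidem p \<Longrightarrow> p * a * p = c *\<^sub>C p \<Longrightarrow> coef p a = c"
  unfolding coef_def by (rule the_equality) (use cscale_left_cancel minidem_def in metis)+

lemma coef: "minidem p \<Longrightarrow> p * a * p = coef p a *\<^sub>C p"
  using coef_eqI unfolding minidem_def by metis

lemma minidem_idem: "minidem p \<Longrightarrow> p * p = p" and minidem_nonzero: "minidem p \<Longrightarrow> p \<noteq> 0"
  unfolding minidem_def by auto

lemma coef_add: "minidem p \<Longrightarrow> coef p (a + b) = coef p a + coef p b"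
  by (rule coef_eqI) (simp_all add: coef[symmetric] cs.add_left algebra_simps)

lemma coef_scale: "minidem p \<Longrightarrow> coef p (c *\<^sub>C a) = c * coef p a"
  by (rule coef_eqI) (simp_all add: coef cscale_simps flip: cscale_cscale)

lemma coef_zero [simp]: "minidem p \<Longrightarrow> coef p 0 = 0"
  by (rule coef_eqI) simp_all

text \<open>The rank-one case of the trace property. The product \<open>p a e b p a e\<close> is a
  scalar multiple of \<open>p a e\<close> whether the first or the last factors are compressed, so
  the scalars agree; if \<open>p a e = 0\<close>, both are 0.\<close>

lemma coef_swap:
  assumes p: "minidem p" and e: "minidem e"
  shows "coef p (a * e * b) = coef e (b * p * a)"
proof -
  let ?u = "p * a * e"
  have "coef p (a * e * b) *\<^sub>C ?u = (p * (a * e * b) * p) * a * e"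
    by (simp add: coef[OF p] cscale_simps)
  also have "\<dots> = p * a * (e * (b * p * a) * e)" by (simp add: mult.assoc)
  also have "\<dots> = coef e (b * p * a) *\<^sub>C ?u" by (simp add: coef[OF e] cscale_simps)
  finally have eq: "coef p (a * e * b) *\<^sub>C ?u = coef e (b * p * a) *\<^sub>C ?u" .
  show ?thesis
  proof (cases "?u = 0")
    case True
    have "p * (a * e * b) * p = ?u * b * p" "e * (b * p * a) * e = e * b * ?u"
      by (simp_all add: mult.assoc)
    then have "coef p (a * e * b) = 0" "coef e (b * p * a) = 0"
      using True p e by (auto intro!: coef_eqI)
    then show ?thesis by simp
  qed (use eq cscale_left_cancel in blast)
qed

text \<open>Compressing any \<open>c\<close> by \<open>a p b\<close> passes through
  \<open>p (b c a) p\<close>, a multiple of \<open>p\<close>. New minimal idempotents are recognised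
  in this way.\<close>

lemma minidem_factor:
  assumes "minidem p" "(a * p * b) * (a * p * b) = a * p * b" "a * p * b \<noteq> 0"
  shows "minidem (a * p * b)"
proof -
  have "(a * p * b) * c * (a * p * b) = coef p (b * c * a) *\<^sub>C (a * p * b)" for c
  proof -
    have "(a * p * b) * c * (a * p * b) = a * (p * (b * c * a) * p) * b" by (simp add: mult.assoc)
    then show ?thesis by (simp add: coef[OF assms(1)] cscale_simps)
  qed
  then show ?thesis using assms unfolding minidem_def by blast
qed

text \<open>Orthogonality to the sum of the later entries is the form that inductions use; pairwise
  orthogonality is implicit, because each entry absorbs the sum it belongs to
  (\<open>orth_mem\<close>).\<close>

fun orth :: "'a::complex_banach_algebra_1 list \<Rightarrow> bool" where
  "orth [] \<longleftrightarrow> True"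
| "orth (f # es) \<longleftrightarrow> minidem f \<and> orth es \<and> f * sum_list es = 0 \<and> sum_list es * f = 0"

lemma orth_idem: "orth es \<Longrightarrow> sum_list es * sum_list es = sum_list es"
  by (induction es) (auto simp: algebra_simps minidem_idem)

lemma orth_mem:
  "orth es \<Longrightarrow> e \<in> set es \<Longrightarrow> minidem e \<and> e * sum_list es = e \<and> sum_list es * e = e"
proof (induction es)
  case (Cons f es)
  show ?case
  proof (cases "e = f")
    case False
    then have IH: "minidem e" "e * sum_list es = e" "sum_list es * e = e" using Cons by auto
    have "e * f = e * (sum_list es * f)" "f * e = (f * sum_list es) * e"
      using IH(2,3) by (simp_all add: mult.assoc) (metis mult.assoc)
    then have "e * f = 0" "f * e = 0" using Cons.prems by auto
    then show ?thesis using IH by (simp add: distrib_left distrib_right)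
  qed (use Cons.prems in \<open>simp add: distrib_left distrib_right minidem_idem\<close>)
qed simp

definition tsum :: "'a::complex_banach_algebra_1 list \<Rightarrow> 'a \<Rightarrow> complex" where
  "tsum es x = (\<Sum>e\<leftarrow>es. coef e x)"

lemma tsum_simps [simp]: "tsum [] x = 0" "tsum (e # es) x = coef e x + tsum es x"
  by (simp_all add: tsum_def)

lemma tsum_add: "orth es \<Longrightarrow> tsum es (x + y) = tsum es x + tsum es y"
  by (induction es) (auto simp: coef_add)

lemma tsum_scale: "orth es \<Longrightarrow> tsum es (c *\<^sub>C x) = c * tsum es x"
  by (induction es) (auto simp: coef_scale algebra_simps)

lemma tsum_zero [simp]: "orth es \<Longrightarrow> tsum es 0 = 0"
  by (induction es) auto

lemma tsum_cong:
  assumes "\<And>e. e \<in> set es \<Longrightarrow> e * x = e * y"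
  shows "tsum es x = tsum es y"
  using assms by (induction es) (simp_all add: coef_def)

lemma coef_eq_tsum:
  assumes "minidem e" "orth fs"
  shows "coef e (a * sum_list fs * b) = tsum fs (b * e * a)"
  using assms by (induction fs) (auto simp: distrib_left distrib_right coef_add coef_swap[OF assms(1)])

lemma tsum_swap:
  assumes "orth es" "orth fs"
  shows "tsum es (a * sum_list fs * b) = tsum fs (b * sum_list es * a)"
  using assms by (induction es) (auto simp: distrib_left distrib_right coef_eq_tsum tsum_add)

text \<open>This makes the trace independent of the idempotent. Since \<open>x\<close> absorbs
  \<open>sum_list es\<close>, \<open>tsum_swap\<close> moves the count from \<open>fs\<close> to
  \<open>es\<close>, and each member of \<open>es\<close> absorbs \<open>sum_list fs\<close> by the
  third assumption.\<close>

lemma tsum_eqI: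
  assumes "orth es" "orth fs" "sum_list es * sum_list fs = sum_list es" "x * sum_list es = x"
  shows "tsum fs x = tsum es x"
proof -
  have "tsum fs x = tsum es (sum_list fs * x)"
    using tsum_swap[OF assms(2,1), of x 1] assms(4) by simp
  also have "\<dots> = tsum es x"
    by (rule tsum_cong) (metis assms(1,3) mult.assoc orth_mem)
  finally show ?thesis .
qed

lemma tsum_self: 
  assumes "orth es" shows "tsum es (sum_list es) = of_nat (length es)"
proof -
  have "tsum fs (sum_list es) = of_nat (length fs)" if "set fs \<subseteq> set es" for fs
    using that
  proof (induction fs)
    case (Cons f fs)
    then have "minidem f" "f * sum_list es * f = 1 *\<^sub>C f"
      using orth_mem[OF assms, of f] by (auto simp: minidem_idem cscale_one)
    then show ?case using Cons by (simp add: coef_eqI)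
  qed simp
  then show ?thesis by simp
qed

text \<open>In a semi-simple algebra this is the socle (\<open>socle_eq_finrank\<close>). One
  absorbing idempotent on the right stands for a finite sum of rank-one terms; stability under right
  multiplication then needs proof (\<open>finrank_mult_right\<close>).\<close>

definition finrank :: "'a::complex_banach_algebra_1 set" where
  "finrank = {x. \<exists>es. orth es \<and> x * sum_list es = x}"

definition ftrace :: "'a::complex_banach_algebra_1 \<Rightarrow> complex" where
  "ftrace x = tsum (SOME es. orth es \<and> x * sum_list es = x) x"

section \<open>Regularity, extension of orthogonal families and the trace in a semiprime
  algebra\<close>

locale semiprime_banach =
  fixes A :: "'a::complex_banach_algebra_1 itself"
  assumes semiprime: "(\<And>z. u * z * u = 0) \<Longrightarrow> u = (0::'a)"
begin

text \<open>With \<open>u = a p b\<close>, every \<open>u z u\<close> is a multiple of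
  \<open>u\<close>, because its middle lies in \<open>pAp\<close>. Semiprimeness gives a
  \<open>z\<close> with nonzero multiple, and rescaling makes it 1.\<close>

lemma rank_one_regular:
  fixes p :: 'a
  assumes "minidem p"
  shows "\<exists>v. (a * p * b) * v * (a * p * b) = a * p * b"
proof (cases "a * p * b = 0")
  case False
  then obtain z where z: "(a * p * b) * z * (a * p * b) \<noteq> 0" using semiprime by blast
  have "(a * p * b) * z * (a * p * b) = a * (p * (b * z * a) * p) * b" by (simp add: mult.assoc)
  then have eq: "(a * p * b) * z * (a * p * b) = coef p (b * z * a) *\<^sub>C (a * p * b)"
    by (simp add: coef[OF assms] cscale_simps)
  then have "coef p (b * z * a) \<noteq> 0" using z by auto
  then have "(a * p * b) * (inverse (coef p (b * z * a)) *\<^sub>C z) * (a * p * b) = a * p * b"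
    using eq by (simp add: cscale_simps)
  then show ?thesis by blast
qed simp

text \<open>The Gram--Schmidt step: \<open>u = p (1 - q)\<close> is the part of \<open>p\<close>
  outside \<open>Aq\<close>. A regular inverse \<open>v\<close> of \<open>u\<close> gives the
  idempotent \<open>f = (1 - q) v u\<close>; its two outer factors \<open>1 - q\<close> make it
  orthogonal to \<open>q\<close>, and \<open>p f = u\<close> restores the missing part.\<close>

lemma orth_extend_one:
  fixes p :: 'a
  assumes es: "orth es" and p: "minidem p"
  shows "\<exists>fs. orth fs \<and> sum_list es * sum_list fs = sum_list es \<and> p * sum_list fs = p"
proof (cases "p * sum_list es = p")
  case False
  define q where "q = sum_list es"
  define u where "u = p * (1 - q)"
  have q: "q * q = q" unfolding q_def by (rule orth_idem[OF es])
  have u: "u \<noteq> 0" using False unfolding u_def q_def by (simp add: algebra_simps)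
  obtain v where v: "u * v * u = u" using rank_one_regular[OF p, of 1 "1 - q"] unfolding u_def by auto
  define f where "f = ((1 - q) * v) * p * (1 - q)"
  have fu: "f = (1 - q) * v * u" unfolding f_def u_def by (simp add: mult.assoc)
  have uq: "u * (1 - q) = u" unfolding u_def using q by (simp add: algebra_simps)
  have uf: "u * f = u" unfolding fu using uq v by (metis mult.assoc)
  have ff: "f * f = f" by (metis fu uf mult.assoc)
  have f0: "f \<noteq> 0" using uf u by auto
  have f: "minidem f" using minidem_factor[OF p] ff f0 unfolding f_def by blast
  have qf: "q * f = 0" "f * q = 0" unfolding fu u_def using q by (simp_all add: algebra_simps) (simp_all add: mult.assoc[symmetric] q)
  have "p * f = u * (v * u)" unfolding fu u_def by (simp add: mult.assoc)
  then have "p * f = u" using v by (simp add: mult.assoc)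
  then have "p * f = p - p * q" by (simp add: u_def right_diff_distrib)
  then have "orth (f # es)" "q * sum_list (f # es) = q" "p * sum_list (f # es) = p"
    using es f qf q unfolding q_def by (simp_all add: distrib_left)
  then show ?thesis unfolding q_def by blast
qed (use es orth_idem in blast)

lemma orth_extend:
  fixes ps :: "'a list"
  assumes "orth es" "\<And>p. p \<in> set ps \<Longrightarrow> minidem p"
  shows "\<exists>fs. orth fs \<and> sum_list es * sum_list fs = sum_list es \<and> sum_list ps * sum_list fs = sum_list ps"
  using assms(2)
proof (induction ps)
  case Nil
  then show ?case using assms(1) orth_idem by auto
next
  case (Cons p ps)
  then obtain fs where fs: "orth fs" "sum_list es * sum_list fs = sum_list es"
    "sum_list ps * sum_list fs = sum_list ps" by auto
  obtain gs where gs: "orth gs" "sum_list fs * sum_list gs = sum_list fs" "p * sum_list gs = p"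
    using orth_extend_one[OF fs(1), of p] Cons.prems by auto
  have "sum_list es * sum_list gs = sum_list es" "sum_list ps * sum_list gs = sum_list ps"
    using fs gs by (metis mult.assoc)+
  then show ?case using gs by (auto simp: distrib_right intro!: exI[of _ gs])
qed

lemma finrank_common:
  fixes x y :: 'a
  assumes "x \<in> finrank" "y \<in> finrank"
  obtains es where "orth es" "x * sum_list es = x" "y * sum_list es = y"
proof -
  obtain es fs where e: "orth es" "x * sum_list es = x" "orth fs" "y * sum_list fs = y"
    using assms unfolding finrank_def by auto
  obtain gs where g: "orth gs" "sum_list es * sum_list gs = sum_list es" "sum_list fs * sum_list gs = sum_list fs"
    using orth_extend[OF e(1), of fs] orth_mem[OF e(3)] by blast
  have "x * sum_list gs = x" "y * sum_list gs = y" using e g by (metis mult.assoc)+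
  then show ?thesis using that g(1) by blast
qed

lemma ftrace_eq:
  fixes x :: 'a
  assumes "orth es" "x * sum_list es = x"
  shows "ftrace x = tsum es x"
proof -
  define fs where "fs = (SOME es. orth es \<and> x * sum_list es = x)"
  have fs: "orth fs" "x * sum_list fs = x"
    using someI[of "\<lambda>es. orth es \<and> x * sum_list es = x" es] assms unfolding fs_def by auto
  obtain gs where g: "orth gs" "sum_list es * sum_list gs = sum_list es" "sum_list fs * sum_list gs = sum_list fs"
    using orth_extend[OF assms(1), of fs] orth_mem[OF fs(1)] by blast
  have "tsum gs x = tsum es x" "tsum gs x = tsum fs x"
    using tsum_eqI assms fs g by blast+
  then show ?thesis unfolding ftrace_def fs_def by simp
qed

lemma finrank_zero: "(0::'a) \<in> finrank"
  unfolding finrank_def by (auto intro: exI[of _ "[]"])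

lemma finrank_add: "x \<in> finrank \<Longrightarrow> y \<in> finrank \<Longrightarrow> x + (y::'a) \<in> finrank"
  by (rule finrank_common[of x y]) (auto simp: finrank_def distrib_right)

lemma finrank_mult_left: "x \<in> finrank \<Longrightarrow> b * (x::'a) \<in> finrank"
  unfolding finrank_def by (auto simp: mult.assoc)

lemma finrank_scale: "x \<in> finrank \<Longrightarrow> c *\<^sub>C (x::'a) \<in> finrank"
  unfolding finrank_def by (auto simp: cscale_simps)

lemma finrank_minus: "x \<in> finrank \<Longrightarrow> - (x::'a) \<in> finrank"
  using finrank_mult_left[of x "-1"] by simp

lemma finrank_diff: "x \<in> finrank \<Longrightarrow> y \<in> finrank \<Longrightarrow> x - (y::'a) \<in> finrank"
  using finrank_add[of x "-y"] finrank_minus by simp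

text \<open>A right multiple need not absorb the old idempotent. Regularity supplies a new one,
  \<open>v * p * b\<close>, which is minimal because it factors through \<open>p\<close>.\<close>

lemma minidem_mult_finrank:
  fixes p :: 'a
  assumes p: "minidem p"
  shows "p * b \<in> finrank"
proof (cases "p * b = 0")
  case False
  obtain v where v: "(p * b) * v * (p * b) = p * b" using rank_one_regular[OF p, of 1 b] by auto
  have "(p * b) * (v * p * b) = p * b" using v by (simp add: mult.assoc)
  moreover from this have "minidem (v * p * b)"
    by (intro minidem_factor[OF p]) (use False in \<open>auto simp: mult.assoc\<close>)
  ultimately show ?thesis unfolding finrank_def by (intro CollectI exI[of _ "[v * p * b]"]) simp
qed (simp add: finrank_zero)

lemma orth_mult_finrank: "orth es \<Longrightarrow> sum_list es * (b::'a) \<in> finrank"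
  by (induction es) (auto simp: distrib_right finrank_zero intro: finrank_add minidem_mult_finrank)

lemma finrank_mult_right:
  assumes "x \<in> finrank"
  shows "x * (b::'a) \<in> finrank"
proof -
  obtain es where "orth es" "x * sum_list es = x" using assms unfolding finrank_def by blast
  then show ?thesis using finrank_mult_left[OF orth_mult_finrank[of es b], of x]
    by (simp add: mult.assoc[symmetric])
qed

lemma ftrace_add:
  fixes x y :: 'a
  assumes "x \<in> finrank" "y \<in> finrank"
  shows "ftrace (x + y) = ftrace x + ftrace y"
proof -
  obtain es where "orth es" "x * sum_list es = x" "y * sum_list es = y"
    using finrank_common assms by blast
  then show ?thesis by (simp add: ftrace_eq[of es] distrib_right tsum_add)
qed

lemma ftrace_scale:
  fixes x :: 'a
  assumes "x \<in> finrank"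
  shows "ftrace (c *\<^sub>C x) = c * ftrace x"
proof -
  obtain es where "orth es" "x * sum_list es = x" using assms unfolding finrank_def by blast
  then show ?thesis by (simp add: ftrace_eq[of es] cscale_simps tsum_scale)
qed

lemma ftrace_zero [simp]: "ftrace (0::'a) = 0"
  using ftrace_eq[of "[]" "0::'a"] by simp

lemma ftrace_diff:
  fixes x y :: 'a
  assumes "x \<in> finrank" "y \<in> finrank"
  shows "ftrace (x - y) = ftrace x - ftrace y"
  using ftrace_add[of "x - y" y] assms finrank_diff by auto

text \<open>The elements \<open>x * b\<close> and \<open>b * x\<close> absorb different idempotents:
  \<open>q\<close> for the latter, and for the former one that \<open>q * b\<close> absorbs. Writing
  \<open>x * b = x * q * b\<close> brings the two into the position required by
  \<open>tsum_swap\<close>.\<close>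

lemma ftrace_mult_commute:
  fixes x :: 'a
  assumes "x \<in> finrank"
  shows "ftrace (x * b) = ftrace (b * x)"
proof -
  obtain es where es: "orth es" "x * sum_list es = x" using assms unfolding finrank_def by blast
  define q where "q = sum_list es"
  obtain fs where fs: "orth fs" "(q * b) * sum_list fs = q * b"
    using orth_mult_finrank[OF es(1), of b] unfolding finrank_def q_def by blast
  have xq: "x * q = x" using es unfolding q_def by simp
  have xb: "x * b = x * q * b" using xq by simp
  have "x * b * sum_list fs = x * b" unfolding xb using fs(2) by (simp add: mult.assoc)
  then have "ftrace (x * b) = tsum fs (x * q * b)" using ftrace_eq[OF fs(1)] xb by metis
  also have "\<dots> = tsum es (b * sum_list fs * x)" unfolding q_def by (rule tsum_swap[OF fs(1) es(1)])
  also have "\<dots> = tsum es (b * x)"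
  proof (rule tsum_cong)
    fix e assume "e \<in> set es"
    then have "e * q = e" using orth_mem[OF es(1)] unfolding q_def by blast
    then have "e * (b * sum_list fs * x) = e * (q * b * sum_list fs) * x"
      by (simp add: mult.assoc[symmetric])
    also have "\<dots> = e * (b * x)" unfolding fs(2) using \<open>e * q = e\<close> by (simp add: mult.assoc[symmetric])
    finally show "e * (b * sum_list fs * x) = e * (b * x)" .
  qed
  also have "\<dots> = ftrace (b * x)" using ftrace_eq[OF es(1), of "b * x"] es(2) by (simp add: mult.assoc)
  finally show ?thesis .
qed

lemma orth_finrank: "orth es \<Longrightarrow> sum_list (es::'a list) \<in> finrank"
  using orth_mult_finrank[of es 1] by simp

lemma ftrace_orth: "orth es \<Longrightarrow> ftrace (sum_list (es::'a list)) = of_nat (length es)"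
  using ftrace_eq[of es "sum_list es"] orth_idem[of es] tsum_self by simp

text \<open>McCoy's lemma: $x$ is regular as soon as some $x - xyx$ is; this removes one minimal idempotent at a time.\<close>

lemma finrank_regular:
  fixes x :: 'a
  assumes "x \<in> finrank"
  shows "\<exists>z. x * z * x = x"
proof -
  have "\<exists>z. x * z * x = x" if "orth es" "x * sum_list es = x" for es and x :: 'a
    using that
  proof (induction es arbitrary: x)
    case (Cons f es)
    obtain v where v: "x * f * v * (x * f) = x * f"
      using rank_one_regular[of f x 1] Cons.prems by auto
    \<comment> \<open>This correction annihilates \<open>f\<close>, so \<open>y\<close> absorbs the
      shorter sum and the induction hypothesis makes it regular.\<close>
    define y where "y = x - x * (f * v) * x"
    have "y * f = 0" unfolding y_def using v by (simp add: algebra_simps)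
    moreover have "y * (f + sum_list es) = y"
      using Cons.prems(2) unfolding y_def left_diff_distrib by (simp add: mult.assoc)
    ultimately have "y * sum_list es = y" by (simp add: distrib_left)
    then obtain z where "y * z * y = y" using Cons by auto
    moreover have "y = x * (1 - f * v * x)" "y = (1 - x * f * v) * x"
      unfolding y_def by (simp_all add: algebra_simps)
    ultimately have "x * ((1 - f * v * x) * z * (1 - x * f * v)) * x = y"
      by (metis mult.assoc)
    then have "x * (f * v + (1 - f * v * x) * z * (1 - x * f * v)) * x = x"
      by (simp only: distrib_left[of x] distrib_right[of _ _ x]) (simp add: y_def)
    then show ?case by blast
  qed auto
  then show ?thesis using assms unfolding finrank_def by blast
qed

text \<open>If $xzx = x$, then $x$ and $zx^2$ have the same trace, and the nilpotency order of $zx^2$ is smaller.\<close>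

lemma ftrace_nilpotent:
  fixes x :: 'a
  assumes "x \<in> finrank" "x ^ n = 0"
  shows "ftrace x = 0"
  using assms
proof (induction n arbitrary: x)
  case (Suc n)
  obtain z where z: "x * z * x = x" using finrank_regular Suc.prems by blast
  \<comment> \<open>Each inner \<open>z\<close> disappears through \<open>x * z * x = x\<close>;
    hence a power of \<open>z * x * x\<close> has one more factor \<open>x\<close> than its
    exponent, which lowers the nilpotency order by one.\<close>
  have pw: "(z * x * x) ^ k * (z * x) = z * x ^ Suc k" for k
  proof (induction k)
    case (Suc k)
    have "(z * x * x) ^ Suc k * (z * x) = z * x * x * (z * x ^ Suc k)" using Suc by (simp add: mult.assoc)
    also have "\<dots> = z * x * (x * z * x) * x ^ k" by (simp add: mult.assoc)
    finally show ?case unfolding z by (simp add: mult.assoc)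
  qed simp
  show ?case
  proof (cases n)
    case (Suc m)
    have "(z * x * x) ^ Suc m = (z * x * x) ^ m * (z * x) * x" by (simp only: power_Suc2 mult.assoc)
    also have "\<dots> = z * x ^ Suc (Suc m)" unfolding pw by (simp only: power_Suc2 mult.assoc)
    finally have nil: "(z * x * x) ^ n = 0" using Suc.prems Suc by simp
    have "ftrace x = ftrace (x * (z * x))" using z by (simp add: mult.assoc)
    also have "\<dots> = ftrace (z * x * x)" by (rule ftrace_mult_commute[OF Suc.prems(1)])
    also have "\<dots> = 0" using Suc.IH nil Suc.prems(1) finrank_mult_left by blast
    finally show ?thesis .
  qed (use Suc.prems in simp)
qed (simp)

text \<open>Elimination along \<open>es\<close>: if \<open>P * f\<close> is nonzero, regularity
  gives a minimal idempotent \<open>g\<close> below \<open>P\<close> with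
  \<open>g * (P * f) = P * f\<close>. Then \<open>P - g\<close> kills \<open>f\<close> and lives on
  the shorter list. The length bound later limits the number of spectral points.\<close>

lemma idempotent_decomposition:
  fixes P :: 'a
  assumes "orth es" "P * P = P" "P * sum_list es = P"
  shows "\<exists>fs. orth fs \<and> sum_list fs = P \<and> length fs \<le> length es"
  using assms
proof (induction es arbitrary: P)
  case Nil
  then show ?case by (intro exI[of _ "[]"]) auto
next
  case (Cons f es)
  have f: "minidem f" using Cons.prems by simp
  define u where "u = P * f"
  show ?case
  proof (cases "u = 0")
    case True
    then have "P * sum_list es = P" using Cons.prems(3) unfolding u_def by (simp add: distrib_left)
    then show ?thesis using Cons.IH[of P] Cons.prems by (auto intro: le_SucI)
  next
    case False
    obtain v where "u * v * u = u" using rank_one_regular[OF f, of P 1] unfolding u_def by auto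
    moreover have uf: "u * f = u" unfolding u_def using f by (simp add: mult.assoc minidem_idem)
    have Pu: "P * u = u" unfolding u_def using Cons.prems(2) by (simp add: mult.assoc[symmetric])
    define g where "g = P * f * (v * P)"
    have gu: "g = u * v * P" unfolding g_def u_def by (simp add: mult.assoc)
    have g_u: "g * u = u" using \<open>u * v * u = u\<close> Pu unfolding gu by (simp add: mult.assoc)
    have Pg: "P * g = g" "g * P = g" unfolding gu using Pu Cons.prems(2) 
      by (simp_all add: mult.assoc[symmetric]) (simp add: mult.assoc)
    have gg: "g * g = g" using g_u Pg unfolding gu by (metis mult.assoc)
    have "g \<noteq> 0" using g_u False by auto
    then have g: "minidem g" using minidem_factor[OF f] gg unfolding g_def by blast
    define P' where "P' = P - g"
    have P': "P' * P' = P'" "g * P' = 0" "P' * g = 0"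
      unfolding P'_def using Pg gg Cons.prems(2) by (simp_all add: algebra_simps)
    have "P' * f = 0" unfolding P'_def using g_u Pg
      by (simp add: left_diff_distrib) (metis mult.assoc u_def)
    moreover have "P' * (f + sum_list es) = P'"
      unfolding P'_def left_diff_distrib using Cons.prems(3) Pg(2) by simp (metis mult.assoc)
    ultimately have "P' * sum_list es = P'" by (simp add: distrib_left)
    then obtain fs where fs: "orth fs" "sum_list fs = P'" "length fs \<le> length es"
      using Cons.IH[of P'] P' Cons.prems by auto
    then have "orth (g # fs)" "sum_list (g # fs) = P" using g P' unfolding P'_def by auto
    then show ?thesis using fs(3) by (intro exI[of _ "g # fs"]) auto
  qed
qed

end

section \<open>Spectral decomposition and the spectral trace\<close>

text \<open>A monic polynomial evaluated at \<open>x\<close>, represented by the list of its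
  roots.\<close>

definition linprod :: "'a::complex_banach_algebra_1 \<Rightarrow> complex list \<Rightarrow> 'a" where
  "linprod x ls = prod_list (map (\<lambda>l. x - l *\<^sub>C 1) ls)"

lemma linprod_simps [simp]:
  "linprod x [] = 1" "linprod x (l # ls) = (x - l *\<^sub>C 1) * linprod x ls"
  by (simp_all add: linprod_def)

lemma linprod_intertwine:
  assumes "z * x = y * z"
  shows "z * linprod x ls = linprod y ls * z"
proof (induction ls)
  case (Cons l ls)
  have "z * (x - l *\<^sub>C 1) = (y - l *\<^sub>C 1) * z" using assms by (simp add: cscale_algebra)
  then have "z * linprod x (l # ls) = (y - l *\<^sub>C 1) * (z * linprod x ls)"
    by (simp add: mult.assoc[symmetric])
  then show ?case using Cons by (simp add: mult.assoc)
qed simp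

lemma linprod_append: "linprod x (ls @ ms) = linprod x ls * linprod x ms"
  by (simp add: linprod_def)

text \<open>Separates the root \<open>l\<close> with its multiplicity \<open>n\<close>; the cofactor
  has value \<open>c\<close>, nonzero, at \<open>l\<close>. This plays the part of a Bezout
  identity. \<open>S\<close> commutes with the commutant of \<open>x\<close> because it is built
  from \<open>x\<close> alone.\<close>

lemma linprod_expand:
  fixes x :: "'a::complex_banach_algebra_1"
  shows "\<exists>n c S. c \<noteq> 0 \<and> (\<forall>z. z * x = x * z \<longrightarrow> z * S = S * z) \<and>
    linprod x ls = (x - l *\<^sub>C 1) ^ n * (c *\<^sub>C 1 + (x - l *\<^sub>C 1) * S)"
proof (induction ls)
  case Nil
  show ?case by (rule exI[of _ 0], rule exI[of _ 1], rule exI[of _ 0]) (simp add: cscale_one)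
next
  case (Cons m ls)
  define y where "y = x - l *\<^sub>C 1"
  obtain n c S where S: "c \<noteq> 0" "\<And>z. z * x = x * z \<Longrightarrow> z * S = S * z"
    "linprod x ls = y ^ n * (c *\<^sub>C 1 + y * S)" using Cons unfolding y_def by blast
  have xy: "x - m *\<^sub>C 1 = (l - m) *\<^sub>C 1 + y" unfolding y_def by (simp add: cscale_algebra)
  show ?case
  proof (cases "m = l")
    case True
    then have "linprod x (m # ls) = y ^ Suc n * (c *\<^sub>C 1 + y * S)"
      unfolding linprod_simps S(3) xy by (simp add: mult.assoc)
    then show ?thesis using S(1,2) unfolding y_def by blast
  next
    case False
    define S' where "S' = (l - m) *\<^sub>C S + c *\<^sub>C 1 + y * S"
    have "linprod x (m # ls) = ((l - m) *\<^sub>C 1 + y) * y ^ n * (c *\<^sub>C 1 + y * S)"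
      unfolding linprod_simps S(3) xy by (simp add: mult.assoc)
    also have "((l - m) *\<^sub>C 1 + y) * y ^ n = y ^ n * ((l - m) *\<^sub>C 1 + y)"
      by (simp add: cscale_algebra power_commutes)
    finally have "linprod x (m # ls) = y ^ n * (((l - m) * c) *\<^sub>C 1 + y * S')"
      unfolding S'_def by (simp add: mult.assoc) (simp add: cscale_algebra)
    moreover have "z * S' = S' * z" if z: "z * x = x * z" for z
    proof -
      have "z * y = y * z" unfolding y_def using z by (simp add: cscale_algebra)
      then have "z * (y * S) = (y * S) * z" using S(2)[OF z] by (metis mult.assoc)
      then show ?thesis unfolding S'_def using S(2)[OF z] by (simp add: distrib_left distrib_right cscale_simps)
    qed
    ultimately show ?thesis using False S(1) unfolding y_def[symmetric]
      by (intro exI[of _ n] exI[of _ "(l - m) * c"] exI[of _ S']) auto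
  qed
qed

text \<open>Solving the factored relation for \<open>y ^ n\<close> gives
  \<open>y ^ n = y ^ n * y * s\<close> with \<open>s\<close> commuting with \<open>y\<close>.
  Consequently a high power of \<open>y * s\<close> is an idempotent on which \<open>y\<close> is
  invertible, and \<open>Q\<close> is its complement.\<close>

lemma fitting_exists:
  fixes x :: "'a::complex_banach_algebra_1"
  assumes "linprod x ls = 0"
  shows "\<exists>Q. fitting x l Q"
proof -
  define y where "y = x - l *\<^sub>C 1"
  obtain n c S where S: "c \<noteq> 0" "\<And>z. z * x = x * z \<Longrightarrow> z * S = S * z"
    "y ^ n * (c *\<^sub>C 1 + y * S) = 0" using linprod_expand[of x ls l] assms unfolding y_def by auto
  define s where "s = (- inverse c) *\<^sub>C S"
  have sc: "z * s = s * z" if "z * x = x * z" for z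
    unfolding s_def using S(2)[OF that] by (simp add: cscale_simps)
  have yx: "z * y = y * z" if "z * x = x * z" for z
    unfolding y_def using that by (simp add: cscale_algebra)
  have ys: "y * s = s * y" using sc[of y] yx[of x] by simp
  have "c *\<^sub>C y ^ n = - (y ^ n * y * S)" using S(3)
    by (simp add: distrib_left cscale_simps mult.assoc eq_neg_iff_add_eq_0)
  then have "inverse c *\<^sub>C (c *\<^sub>C y ^ n) = inverse c *\<^sub>C (- (y ^ n * y * S))" by simp
  then have "y ^ n = y ^ n * y * s" unfolding s_def using S(1) by (simp add: cscale_simps)
  then have "y ^ Suc n * y * s = y ^ Suc n" by (simp add: mult.assoc)
  then have step: "y ^ Suc n * (y * s) = y ^ Suc n" by (simp add: mult.assoc)
  \<comment> \<open>A positive exponent, so that one factor \<open>y\<close> can be split off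
    \<open>E\<close>, leaving the partial inverse \<open>(y * s) ^ n * s\<close>.\<close>
  define N where "N = Suc n"
  have pow: "y ^ N * (y * s) ^ k = y ^ N" for k
    by (induction k) (use step N_def in \<open>simp_all add: mult.assoc[symmetric]\<close>)
  have ysk: "(y * s) ^ k = y ^ k * s ^ k" for k
  proof (induction k)
    case (Suc k)
    have "s * y ^ k = y ^ k * s" using ys by (metis power_commuting_commutes)
    then show ?case using Suc by (simp add: mult.assoc) (simp add: mult.assoc[symmetric])
  qed simp
  define E where "E = (y * s) ^ N"
  have yE: "y ^ N * E = y ^ N" unfolding E_def by (rule pow)
  have E': "E = s ^ N * y ^ N" unfolding E_def ysk using ys by (metis power_commuting_commutes)
  have EE: "E * E = E" by (metis E' mult.assoc yE)
  have "z * E = E * z" if z: "z * x = x * z" for z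
  proof -
    have "(y * s) * z = z * (y * s)" using sc[OF z] yx[OF z] by (metis mult.assoc)
    then show ?thesis unfolding E_def by (rule power_commuting_commutes[symmetric])
  qed
  moreover have "y * ((y * s) ^ n * s) = E" "((y * s) ^ n * s) * y = E"
  proof -
    have "y * (y * s) = (y * s) * y" by (subst ys) (rule mult.assoc[symmetric])
    then have "y * (y * s) ^ n = (y * s) ^ n * y" by (metis power_commuting_commutes)
    then show "y * ((y * s) ^ n * s) = E" unfolding E_def N_def power_Suc2 by (metis mult.assoc)
    show "((y * s) ^ n * s) * y = E" unfolding E_def N_def power_Suc2 mult.assoc by (subst ys) (rule refl)
  qed
  moreover have "(1 - E) * (1 - E) = 1 - E" "y ^ N * (1 - E) = 0"
    using EE yE by (simp_all add: left_diff_distrib right_diff_distrib)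
  moreover have "z * (1 - E) = (1 - E) * z" if "z * E = E * z" for z
    using that by (simp add: left_diff_distrib right_diff_distrib)
  moreover have "1 - (1 - E) = E" by simp
  ultimately have "fitting x l (1 - E)"
    unfolding fitting_def y_def[symmetric] by metis
  then show ?thesis by blast
qed

text \<open>On \<open>F\<close> the element \<open>x - m\<close> differs from the nonzero scalar
  \<open>l - m\<close> by a nilpotent, so up to a scalar it is the unit \<open>t\<close>. The power
  of \<open>x - m\<close> that kills \<open>G\<close> becomes a power of \<open>t\<close> that kills
  \<open>F * G\<close>, and units cancel.\<close>

lemma fitting_orthogonal:
  fixes x :: "'a::complex_banach_algebra_1"
  assumes F: "fitting x l F" and G: "fitting x m G" and lm: "l \<noteq> m"
  shows "F * G = 0"
proof -
  define y z where "y = x - l *\<^sub>C 1" and "z = x - m *\<^sub>C 1"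
  obtain n k where n: "y ^ n * F = 0" "F * F = F" and k: "z ^ k * G = 0"
    using F G unfolding fitting_def y_def z_def by blast
  have comm: "y * F = F * y" "z * F = F * z"
    using fitting_commute[OF F] unfolding y_def z_def by (simp_all add: cscale_algebra)
  define c where "c = inverse (m - l)"
  have c: "c * (m - l) = 1" using lm unfolding c_def by simp
  define t where "t = 1 - c *\<^sub>C (y * F)"
  have pw: "(c *\<^sub>C (y * F)) ^ j = c ^ j *\<^sub>C (y * F) ^ j" for j
    by (induction j) (simp_all add: cscale_simps mult.commute)
  have "(y * F) ^ Suc n = 0"
    unfolding power_times_idempotent[OF n(2) comm(1)] by (simp add: mult.assoc n(1))
  then have "(c *\<^sub>C (y * F)) ^ Suc n = 0" unfolding pw by simp
  then have "invertible_el t" unfolding t_def by (rule invertible_el_one_minus_nilpotent)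
  then obtain b where b: "b * t = 1" unfolding invertible_el_def by blast
  have "c *\<^sub>C (m *\<^sub>C F) - c *\<^sub>C (l *\<^sub>C F) = F"
    using c by (simp add: cscale_cscale cs.diff_left[symmetric] right_diff_distrib[symmetric] cscale_one)
  moreover have "t * F = F - c *\<^sub>C (y * F)" unfolding t_def using n(2)
    by (simp add: left_diff_distrib cscale_simps mult.assoc)
  moreover have "y * F = z * F + m *\<^sub>C F - l *\<^sub>C F" unfolding y_def z_def by (simp add: cscale_algebra)
  ultimately have tF: "t * F = (- c) *\<^sub>C (z * F)"
    by (simp add: cs.diff_right cs.add_right cscale_simps)
  have t: "t ^ j * F = (- c) ^ j *\<^sub>C (z ^ j * F)" for j
  proof (induction j)
    case (Suc j)
    have "t ^ Suc j * F = t ^ j * (t * F)" by (simp only: power_Suc2 mult.assoc)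
    also have "\<dots> = (- c) *\<^sub>C ((t ^ j * F) * z)" unfolding tF comm(2) by (simp add: cscale_simps mult.assoc)
    also have "\<dots> = (- c) ^ Suc j *\<^sub>C (z ^ j * (F * z))" unfolding Suc by (simp add: cscale_simps mult.assoc)
    also have "z ^ j * (F * z) = z ^ Suc j * F" unfolding comm(2)[symmetric] by (simp only: power_Suc2 mult.assoc)
    finally show ?case .
  qed (simp add: cscale_one)
  have "z ^ k * F = F * z ^ k" using comm(2) by (metis power_commuting_commutes)
  then have "t ^ k * (F * G) = (- c) ^ k *\<^sub>C (F * (z ^ k * G))"
    unfolding mult.assoc[symmetric] t by (simp add: cscale_simps)
  then have tk: "t ^ k * (F * G) = 0" using k by simp
  have "t ^ j * u = 0 \<Longrightarrow> u = 0" for j u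
  proof (induction j)
    case (Suc j)
    then have "b * t * (t ^ j * u) = 0" by (simp add: mult.assoc)
    then show ?case using b Suc.IH by simp
  qed simp
  then show ?thesis using tk by blast
qed

text \<open>Spectral idempotents at nonzero points have finite rank: since
  \<open>x * (1 - q) = 0\<close>, powers of \<open>x - l\<close> act on \<open>1 - q\<close> as
  powers of \<open>- l\<close>, so the power that kills \<open>F\<close> forces
  \<open>F * (1 - q) = 0\<close>.\<close>

lemma fitting_absorb:
  fixes x :: "'a::complex_banach_algebra_1"
  assumes F: "fitting x l F" and l: "l \<noteq> 0" and q: "x * q = x"
  shows "F * q = F"
proof -
  obtain n where n: "(x - l *\<^sub>C 1) ^ n * F = 0" using F unfolding fitting_def by blast
  have pw: "(x - l *\<^sub>C 1) ^ j * (1 - q) = (- l) ^ j *\<^sub>C (1 - q)" for j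
  proof (induction j)
    case (Suc j)
    have "(x - l *\<^sub>C 1) * (1 - q) = (- l) *\<^sub>C (1 - q)" using q by (simp add: cscale_algebra)
    then show ?case using Suc by (simp only: power_Suc2 mult.assoc) (simp add: cscale_simps mult.commute)
  qed (simp add: cscale_one)
  have "F * (x - l *\<^sub>C 1) = (x - l *\<^sub>C 1) * F" using fitting_commute[OF F] by (simp add: cscale_algebra)
  then have "F * (x - l *\<^sub>C 1) ^ n = (x - l *\<^sub>C 1) ^ n * F" by (metis power_commuting_commutes)
  then have "F * ((x - l *\<^sub>C 1) ^ n * (1 - q)) = 0" using n by (simp add: mult.assoc[symmetric])
  then have "F * (1 - q) = 0" unfolding pw using l by (simp add: cscale_simps)
  then show ?thesis by (simp add: algebra_simps)
qed

lemma not_invertible_eigenvector: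
  fixes x :: "'a::complex_banach_algebra_1"
  assumes "x * v = l *\<^sub>C v" "v \<noteq> 0"
  shows "l \<in> alg_spectrum x"
proof (rule ccontr)
  assume "l \<notin> alg_spectrum x"
  then obtain b where "b * (x - l *\<^sub>C 1) = 1" unfolding alg_spectrum_iff invertible_el_def by blast
  then have "v = b * ((x - l *\<^sub>C 1) * v)" by (simp add: mult.assoc[symmetric])
  also have "(x - l *\<^sub>C 1) * v = 0" using assms(1) by (simp add: cscale_algebra)
  finally show False using assms(2) by simp
qed

text \<open>This element has the eigenvalues $1, \dots, n$, hence attains the supremum in the definition of the rank.\<close>

fun orth_weights :: "'a::complex_banach_algebra_1 list \<Rightarrow> 'a" where
  "orth_weights [] = 0"
| "orth_weights (e # es) = of_nat (Suc (length es)) *\<^sub>C e + orth_weights es"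

lemma orth_weights_absorb: "orth es \<Longrightarrow> orth_weights es * sum_list es = orth_weights es
   \<and> sum_list es * orth_weights es = orth_weights es"
proof (induction es)
  case (Cons f es)
  then have IH: "orth_weights es * sum_list es = orth_weights es" "sum_list es * orth_weights es = orth_weights es"
     and f: "f * sum_list es = 0" "sum_list es * f = 0" "f * f = f"
    by (auto simp: minidem_idem)
  have "orth_weights es * f = 0" "f * orth_weights es = 0" using IH f by (metis mult.assoc mult_zero_right mult_zero_left)+
  then show ?case using IH f by (simp add: distrib_left distrib_right cscale_simps)
qed simp

lemma orth_weights_eigenvector:
  assumes "orth es" "k \<in> {1..length es}"
  shows "\<exists>v. v \<noteq> 0 \<and> sum_list es * v = v \<and> orth_weights es * v = of_nat k *\<^sub>C v"
  using assms
proof (induction es)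
  case (Cons f es)
  have f: "f * sum_list es = 0" "sum_list es * f = 0" "f * f = f" "f \<noteq> 0"
    using Cons.prems by (auto simp: minidem_idem minidem_nonzero)
  show ?case
  proof (cases "k = Suc (length es)")
    case True
    have "orth_weights es * f = 0" using f orth_weights_absorb[of es] Cons.prems
      by (metis mult.assoc mult_zero_right orth.simps(2))
    then show ?thesis using f True by (intro exI[of _ f]) (simp add: distrib_right cscale_simps)
  next
    case False
    then obtain v where v: "v \<noteq> 0" "sum_list es * v = v" "orth_weights es * v = of_nat k *\<^sub>C v"
      using Cons by auto
    then have "f * v = 0" using f by (metis mult.assoc mult_zero_left)
    then show ?thesis using v by (intro exI[of _ v]) (simp add: distrib_right cscale_simps)
  qed
qed simp

section \<open>Annihilating products, rank and multiplicity for finite-rank elements\<close>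

context semiprime_banach
begin

text \<open>Triangularisation: the spectrum of $y$ in $qAq$ is nonempty, and since $vz$ and $zv$ have the same trace, a
non-invertible regular $z \in qAq$ has a nonzero right annihilator, which is an eigenspace to split off.\<close>

lemma corner_annihilator:
  fixes y :: 'a
  assumes "orth es" "sum_list es * y = y" "y * sum_list es = y"
  shows "\<exists>ls. linprod y ls * sum_list es = 0"
  using assms
proof (induction es arbitrary: y rule: length_induct)
  case (1 es)
  define q where "q = sum_list es"
  have y: "q * y = y" "y * q = y" and es: "orth es" using 1 unfolding q_def by auto
  have q: "q * q = q" "q \<in> finrank" unfolding q_def using orth_idem orth_finrank es by blast+
  show ?case
  proof (cases "q = 0")
    case False
    obtain l where l: "\<not> (\<exists>b. q * b = b \<and> b * q = b \<and> (y - l *\<^sub>C q) * b = q \<and> b * (y - l *\<^sub>C q) = q)"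
      using corner_spectrum_nonempty[OF q(1) False y] by blast
    define z where "z = y - l *\<^sub>C q"
    have z: "q * z = z" "z * q = z" unfolding z_def using y q by (simp_all add: cscale_algebra)
    have zfin: "z \<in> finrank" using finrank_mult_left[OF q(2), of z] z by simp
    obtain v' where v': "z * v' * z = z" using finrank_regular[OF zfin] by blast
    define v where "v = q * v' * q"
    have v: "q * v = v" "v * q = v" unfolding v_def using q by (simp_all add: mult.assoc) (simp_all add: mult.assoc[symmetric])
    have "z * v * z = (z * q) * v' * (q * z)" unfolding v_def by (simp add: mult.assoc)
    then have zvz: "z * v * z = z" using z v' by simp
    \<comment> \<open>Projections onto the right and left annihilators of \<open>z\<close> in the
      corner. Their equal traces count minimal idempotents, so they vanish together; if they did,
      \<open>v\<close> would invert \<open>z\<close>, against the choice of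
      \<open>l\<close>.\<close>
    define g h where "g = q - v * z" and "h = q - z * v"
    have vz: "(v * z) * (v * z) = v * z" "q * (v * z) = v * z" "(v * z) * q = v * z"
      using zvz v z by (metis mult.assoc)+
    have zv: "(z * v) * (z * v) = z * v" "q * (z * v) = z * v" "(z * v) * q = z * v"
      using zvz v z by (metis mult.assoc)+
    have g: "g * g = g" "q * g = g" "g * q = g" and h: "h * h = h" "h * q = h"
      unfolding g_def h_def using vz zv q by (simp_all add: left_diff_distrib right_diff_distrib)
    have fin: "v * z \<in> finrank" "z * v \<in> finrank" using finrank_mult_left[OF zfin] finrank_mult_right[OF zfin] by blast+
    have tr: "ftrace g = ftrace h"
      unfolding g_def h_def using fin q ftrace_mult_commute[OF zfin, of v] by (simp add: ftrace_diff)
    obtain gs where gs: "orth gs" "sum_list gs = g" using idempotent_decomposition[OF es, of g] g q_def by blast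
    obtain hs where hs: "orth hs" "sum_list hs = h" using idempotent_decomposition[OF es, of h] h q_def by blast
    have len: "length gs = length hs" using tr ftrace_orth[OF gs(1)] ftrace_orth[OF hs(1)] gs hs by simp
    have "gs \<noteq> []"
    proof
      assume "gs = []"
      then have "g = 0" "h = 0" using gs hs len by auto
      then have "v * z = q" "z * v = q" unfolding g_def h_def by auto
      then show False using l v unfolding z_def by blast
    qed
    define g' where "g' = q - g"
    have g': "g' * g' = g'" "g' * q = g'" "g' * g = 0" "g * g' = 0" "q * g' = g'"
      unfolding g'_def using g q by (simp_all add: algebra_simps)
    obtain fs where fs: "orth fs" "sum_list fs = g'"
      using idempotent_decomposition[OF es, of g'] g' q_def by blast
    have "ftrace g' = ftrace q - ftrace g" unfolding g'_def
      using q gs orth_finrank by (intro ftrace_diff) auto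
    then have "of_nat (length fs) = of_nat (length es) - (of_nat (length gs) :: complex)"
      using ftrace_orth[OF fs(1)] ftrace_orth[OF gs(1)] ftrace_orth[OF es] fs gs q_def by simp
    then have "of_nat (length fs + length gs) = (of_nat (length es) :: complex)" by simp
    then have "length fs + length gs = length es" by (simp only: of_nat_eq_iff)
    then have less: "length fs < length es" using \<open>gs \<noteq> []\<close> by (cases gs) auto
    have "z * g = 0" unfolding g_def using z zvz by (simp add: right_diff_distrib mult.assoc)
    then have yg: "y * g = l *\<^sub>C g" unfolding z_def using g by (simp add: cscale_algebra)
    \<comment> \<open>The compression to the complement of the eigenspace, of smaller rank. Because
      \<open>y * g\<close> is a multiple of \<open>g\<close>, \<open>y\<close> is block triangular,
      so \<open>g'\<close> intertwines \<open>y\<close> with \<open>y'\<close>; an annihilator of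
      \<open>y'\<close> therefore pushes \<open>y\<close> into \<open>g\<close>, where the factor
      \<open>y - l\<close> finishes.\<close>
    define y' where "y' = g' * y * g'"
    have "sum_list fs * y' = y'" "y' * sum_list fs = y'"
      unfolding fs y'_def using g'(1) by (simp_all add: mult.assoc) (simp add: mult.assoc[symmetric])
    then obtain ls where ls: "linprod y' ls * g' = 0" using 1(1) less fs by metis
    have "g' * y * g = 0" by (simp add: mult.assoc yg cscale_simps g')
    moreover have "y * (g + g') = y" unfolding g'_def using y by simp
    ultimately have "g' * y = y' * g'"
      unfolding y'_def using g'(1) by (simp add: mult.assoc) (metis add_0 distrib_left mult.assoc)
    then have "g' * linprod y ls = 0" using linprod_intertwine[of g' y y'] ls by simp
    moreover have "q * linprod y ls = linprod y ls * q" by (rule linprod_intertwine) (simp add: y)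
    ultimately have "linprod y ls * q = g * linprod y ls"
      unfolding g'_def by (simp add: algebra_simps)
    then have "linprod y (l # ls) * q = (y - l *\<^sub>C 1) * g * linprod y ls" by (simp add: mult.assoc)
    also have "(y - l *\<^sub>C 1) * g = 0" using yg by (simp add: cscale_algebra)
    finally show ?thesis unfolding q_def by (intro exI[of _ "l # ls"]) simp
  qed (simp add: q_def)
qed

text \<open>Only \<open>x * q = x\<close> is known, so \<open>x\<close> itself need not lie in the
  corner, but \<open>q * x\<close> does. The relation \<open>x * (q * x) = x * x\<close> transfers
  an annihilator of \<open>q * x\<close> to \<open>x\<close> at the cost of one extra root
  0.\<close>

lemma finrank_annihilator:
  fixes x :: 'a
  assumes "x \<in> finrank"
  shows "\<exists>ls. linprod x ls = 0"
proof -
  obtain es where es: "orth es" "x * sum_list es = x" using assms unfolding finrank_def by blast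
  define q where "q = sum_list es"
  have q: "q * q = q" "x * q = x" unfolding q_def using es orth_idem by auto
  have "q * (q * x) = q * x" "(q * x) * q = q * x" using q by (simp_all add: mult.assoc[symmetric]) (simp add: mult.assoc q)
  then obtain ls where ls: "linprod (q * x) ls * q = 0" using corner_annihilator[OF es(1)] unfolding q_def by blast
  have "q * linprod (q * x) ls = linprod (q * x) ls * q"
    by (rule linprod_intertwine) (use q in \<open>simp add: mult.assoc, metis mult.assoc\<close>)
  moreover have "x * linprod (q * x) ls = linprod x ls * x"
    by (rule linprod_intertwine) (use q in \<open>simp add: mult.assoc[symmetric]\<close>)
  ultimately have "linprod x ls * x = 0" using ls q by (metis mult.assoc mult_zero_right)
  then have "linprod x (ls @ [0]) = 0" by (simp add: linprod_append)
  then show ?thesis by blast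
qed

lemma finrank_fitting:
  assumes "(x::'a) \<in> finrank"
  obtains F where "\<And>l. fitting x l (F l)"
  using finrank_annihilator[OF assms] fitting_exists[of x] by metis

lemma idempotent_finrank:
  assumes "P \<in> finrank" "P * P = (P::'a)"
  obtains es where "orth es" "P = sum_list es"
  using assms idempotent_decomposition unfolding finrank_def by blast

text \<open>The spectral idempotents of finitely many nonzero points are nonzero and orthogonal, so
  each adds at least 1 to the trace of their sum \<open>P\<close>. As \<open>P\<close> absorbs
  \<open>sum_list es\<close>, that trace is at most \<open>length es\<close>. Working with finite
  subsets yields finiteness at the same time.\<close>

lemma spectrum_card_le:
  fixes x :: 'a
  assumes es: "orth es" and xq: "x * sum_list es = x"
  shows "finite (alg_spectrum x - {0}) \<and> card (alg_spectrum x - {0}) \<le> length es"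
proof (rule finite_if_finite_subsets_card_bdd)
  fix L assume L: "L \<subseteq> alg_spectrum x - {0}" "finite L"
  have "x \<in> finrank" using assms unfolding finrank_def by blast
  then obtain F where F: "\<And>l. fitting x l (F l)" using finrank_fitting by blast
  have Fq: "F l * sum_list es = F l" if "l \<in> L" for l using fitting_absorb[OF F _ xq] that L by blast
  then have fin: "F l \<in> finrank" if "l \<in> L" for l using that es unfolding finrank_def by blast
  have orthF: "F l * F m = (if l = m then F l else 0)" for l m
    using fitting_orthogonal[OF F F] fitting_idem[OF F] by simp
  define P where "P = (\<Sum>l\<in>L. F l)"
  have Fl: "F l * P = F l" if "l \<in> L" for l
    unfolding P_def using L(2) that by (simp add: sum_distrib_left orthF)
  have "P * P = (\<Sum>l\<in>L. F l * P)" by (subst (1) P_def) (rule sum_distrib_right)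
  also have "\<dots> = P" using Fl unfolding P_def by (intro sum.cong) auto
  finally have "P * P = P" .
  moreover have "P * sum_list es = P" unfolding P_def sum_distrib_right using Fq by (intro sum.cong) auto
  ultimately obtain fs where fs: "orth fs" "sum_list fs = P" "length fs \<le> length es"
    using idempotent_decomposition[OF es] by blast
  have "\<exists>n::nat. n \<ge> card M \<and> (\<Sum>l\<in>M. F l) \<in> finrank \<and> ftrace (\<Sum>l\<in>M. F l) = of_nat n" if "M \<subseteq> L" for M
  proof -
    have "finite M" using that L finite_subset by blast
    then show ?thesis using that
    proof (induction M)
      case empty
      show ?case by (auto simp: finrank_zero intro: exI[of _ 0])
    next
      case (insert l M)
      then obtain n where n: "n \<ge> card M" "(\<Sum>l\<in>M. F l) \<in> finrank" "ftrace (\<Sum>l\<in>M. F l) = of_nat n" by auto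
      obtain gs where gs: "orth gs" "F l = sum_list gs"
        using idempotent_finrank[OF fin[of l]] orthF[of l l] insert.prems by (metis insert_subset)
      have "F l \<noteq> 0" using fitting_eq_0_iff[OF F] L insert by blast
      then have "gs \<noteq> []" using gs by auto
      then have "length gs \<ge> 1" by (cases gs) auto
      moreover have "ftrace (\<Sum>l\<in>insert l M. F l) = of_nat (length gs + n)"
      proof -
        have "F l \<in> finrank" using fin insert.prems by simp
        then show ?thesis
          using insert.hyps n ftrace_add[of "F l"] ftrace_orth[OF gs(1)] gs(2) by simp
      qed
      moreover have "(\<Sum>l\<in>insert l M. F l) \<in> finrank" using insert n fin by (simp add: finrank_add)
      moreover have "card (insert l M) \<le> length gs + n"
        using insert n calculation(1) by simp
      ultimately show ?case by blast
    qed
  qed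
  from this[of L] obtain n where "n \<ge> card L" "ftrace P = of_nat n" unfolding P_def by auto
  then show "card L \<le> length es" using ftrace_orth[OF fs(1)] fs by simp
qed

lemma alg_rank_orth:
  fixes es :: "'a list"
  assumes "orth es"
  shows "alg_rank (sum_list es) = enat (length es)"
proof (rule antisym)
  show "alg_rank (sum_list es) \<le> enat (length es)"
    unfolding alg_rank_def
  proof (rule SUP_least)
    fix y :: 'a
    have "y * sum_list es * sum_list es = y * sum_list es" using orth_idem[OF assms] by (simp add: mult.assoc)
    from spectrum_card_le[OF assms this] show "ecard (alg_spectrum (y * sum_list es) - {0}) \<le> enat (length es)"
      by (simp add: ecard_def)
  qed
  define y where "y = orth_weights es"
  have y: "y * sum_list es = y" unfolding y_def using orth_weights_absorb assms by blast
  have "(of_nat ` {1..length es} :: complex set) \<subseteq> alg_spectrum (y * sum_list es) - {0}"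
    using orth_weights_eigenvector[OF assms] not_invertible_eigenvector unfolding y unfolding y_def by fastforce
  moreover have fin: "finite (alg_spectrum (y * sum_list es) - {0})" using spectrum_card_le[OF assms] y by metis
  moreover have "card (of_nat ` {1..length es} :: complex set) = length es"
    by (simp add: card_image inj_on_def)
  ultimately have "length es \<le> card (alg_spectrum (y * sum_list es) - {0})" by (metis card_mono)
  then have "enat (length es) \<le> ecard (alg_spectrum (y * sum_list es) - {0})"
    using fin by (simp add: ecard_def)
  also have "\<dots> \<le> alg_rank (sum_list es)" unfolding alg_rank_def by (rule SUP_upper) simp
  finally show "enat (length es) \<le> alg_rank (sum_list es)" .
qed

text \<open>The defect \<open>E\<close> is killed by every \<open>F l\<close>, so every
  \<open>x - l\<close> has a left inverse on \<open>E\<close>. The factors of the annihilating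
  product can then be cancelled one after another, leaving \<open>E = 0\<close>.\<close>

lemma fitting_sum_eq_1:
  fixes x :: 'a
  assumes F: "\<And>l. fitting x l (F l)" and ls: "linprod x ls = 0" and fin: "finite (alg_spectrum x)"
  shows "(\<Sum>l\<in>insert 0 (alg_spectrum x). F l) = 1"
proof -
  define P where "P = (\<Sum>l\<in>insert 0 (alg_spectrum x). F l)"
  define E where "E = 1 - P"
  have orthF: "F l * F m = (if l = m then F l else 0)" for l m
    using fitting_orthogonal[OF F F] fitting_idem[OF F] by simp
  have FE: "F l * E = 0" for l
  proof (cases "l \<in> insert 0 (alg_spectrum x)")
    case True
    then show ?thesis unfolding E_def P_def right_diff_distrib sum_distrib_left orthF
      using fin by (simp add: sum.delta)
  next
    case False
    then show ?thesis using fitting_eq_0_iff[OF F, of l] by auto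
  qed
  have xE: "x * E = E * x"
    unfolding E_def P_def left_diff_distrib right_diff_distrib sum_distrib_left sum_distrib_right
    using fitting_commute[OF F] by simp
  have "E * linprod x ms = 0 \<Longrightarrow> E = 0" for ms
  proof (induction ms)
    case (Cons l ms)
    obtain w where w: "w * (x - l *\<^sub>C 1) = 1 - F l" using F unfolding fitting_def by blast
    have "E * (x - l *\<^sub>C 1) = (x - l *\<^sub>C 1) * E" using xE by (simp add: cscale_algebra)
    then have "(x - l *\<^sub>C 1) * (E * linprod x ms) = 0"
      using Cons.prems by (simp add: mult.assoc[symmetric])
    then have "w * (x - l *\<^sub>C 1) * (E * linprod x ms) = 0" by (simp add: mult.assoc)
    then have "E * linprod x ms = F l * E * linprod x ms" unfolding w by (simp add: algebra_simps)
    then show ?case using Cons.IH FE by simp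
  qed simp
  then have "E = 0" using ls by (metis mult_zero_right)
  then show ?thesis unfolding E_def P_def by simp
qed

lemma ftrace_sum:
  assumes "finite L" "\<And>l. l \<in> L \<Longrightarrow> (f l :: 'a) \<in> finrank"
  shows "ftrace (\<Sum>l\<in>L. f l) = (\<Sum>l\<in>L. ftrace (f l))"
proof -
  have "(\<Sum>l\<in>L. f l) \<in> finrank \<and> ftrace (\<Sum>l\<in>L. f l) = (\<Sum>l\<in>L. ftrace (f l))"
    using assms by (induction L) (auto simp: finrank_zero finrank_add ftrace_add)
  then show ?thesis ..
qed

theorem soc_trace_eq_ftrace:
  fixes x :: 'a
  assumes x: "x \<in> finrank"
  shows "soc_trace x = ftrace x"
proof -
  obtain es where es: "orth es" "x * sum_list es = x" using x unfolding finrank_def by blast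
  have fin: "finite (alg_spectrum x)" using spectrum_card_le[OF es] by simp
  obtain F where F: "\<And>l. fitting x l (F l)" using finrank_fitting[OF x] by blast
  obtain ls where ls: "linprod x ls = 0" using finrank_annihilator[OF x] by blast
  have Ffin: "F l \<in> finrank" if "l \<noteq> 0" for l
    using fitting_absorb[OF F that es(2)] es(1) unfolding finrank_def by blast
  have mult: "of_nat (alg_mult l x) = ftrace (F l)" if l: "l \<in> alg_spectrum x" "l \<noteq> 0" for l
  proof -
    have "F l * F l = F l" by (rule fitting_idem[OF F])
    then obtain fs where fs: "orth fs" "F l = sum_list fs" using idempotent_finrank Ffin l by blast
    then show ?thesis unfolding alg_mult_def riesz_proj_eq[OF fin l(1) F] using alg_rank_orth ftrace_orth by simp
  qed
  have tr: "ftrace (x * F l) = l * ftrace (F l)" for l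
  proof -
    define y where "y = x - l *\<^sub>C 1"
    obtain n where n: "y ^ n * F l = 0" "F l * F l = F l" using F unfolding fitting_def y_def by blast
    have "y * F l = F l * y" using fitting_commute[OF F, of l] unfolding y_def by (simp add: cscale_algebra)
    then have nil: "(y * F l) ^ Suc n = 0" using power_times_idempotent[OF n(2)] n(1) by (simp add: mult.assoc)
    show ?thesis
    proof (cases "l = 0")
      \<comment> \<open>\<open>F 0\<close> may have infinite rank, so no trace can be taken of it;
        but \<open>x * F 0\<close> has finite rank through \<open>x\<close>, and it is
        nilpotent.\<close>
      case True
      then have "y = x" unfolding y_def by simp
      then show ?thesis using ftrace_nilpotent[OF _ nil] finrank_mult_right[OF x] True by simp
    next
      case False
      have "ftrace (y * F l) = 0" using ftrace_nilpotent[OF _ nil] finrank_mult_left[OF Ffin[OF False]] by blast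
      moreover have "x * F l = y * F l + l *\<^sub>C F l" unfolding y_def by (simp add: cscale_algebra)
      ultimately show ?thesis
        using Ffin[OF False] by (simp add: ftrace_add ftrace_scale finrank_scale finrank_mult_left)
    qed
  qed
  have "x = (\<Sum>l\<in>insert 0 (alg_spectrum x). x * F l)"
    unfolding sum_distrib_left[symmetric] fitting_sum_eq_1[OF F ls fin] by simp
  then have "ftrace x = (\<Sum>l\<in>insert 0 (alg_spectrum x). ftrace (x * F l))"
    using ftrace_sum[of "insert 0 (alg_spectrum x)" "\<lambda>l. x * F l"] fin finrank_mult_right[OF x] by simp
  also have "\<dots> = (\<Sum>l\<in>alg_spectrum x. l * ftrace (F l))" unfolding tr
    using fin by (cases "0 \<in> alg_spectrum x") (simp_all add: insert_absorb)
  also have "\<dots> = soc_trace x" unfolding soc_trace_def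
  proof (rule sum.cong)
    show "l * ftrace (F l) = of_nat (alg_mult l x) * l" if "l \<in> alg_spectrum x" for l
      using mult[OF that] by (cases "l = 0") simp_all
  qed simp
  finally show ?thesis by simp
qed

end

section \<open>The socle of a semi-simple algebra\<close>

lemma left_idealD:
  assumes "left_ideal L"
  shows "0 \<in> L" "x \<in> L \<Longrightarrow> y \<in> L \<Longrightarrow> x + y \<in> L" "x \<in> L \<Longrightarrow> b * x \<in> L"
    "x \<in> L \<Longrightarrow> y \<in> L \<Longrightarrow> x - y \<in> L"
proof -
  show "0 \<in> L" using assms unfolding left_ideal_def by blast
  have add: "x + y \<in> L" if "x \<in> L" "y \<in> L" for x y using assms that unfolding left_ideal_def by blast
  have mult: "b * x \<in> L" if "x \<in> L" for b x using assms that unfolding left_ideal_def by blast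
  show "x \<in> L \<Longrightarrow> y \<in> L \<Longrightarrow> x + y \<in> L" by (rule add)
  show "x \<in> L \<Longrightarrow> b * x \<in> L" by (rule mult)
  show "x \<in> L \<Longrightarrow> y \<in> L \<Longrightarrow> x - y \<in> L" using add[of x "- 1 * y"] mult[of y "- 1"] by simp
qed

lemma left_idealI:
  assumes "0 \<in> L" "\<And>x y. x \<in> L \<Longrightarrow> y \<in> L \<Longrightarrow> x + y \<in> L" "\<And>b x. x \<in> L \<Longrightarrow> b * x \<in> L"
  shows "left_ideal L"
proof -
  have "c *\<^sub>C x \<in> L" if "x \<in> L" for c x using assms(3)[OF that, of "c *\<^sub>C 1"] by (simp add: cscale_simps)
  then show ?thesis unfolding left_ideal_def using assms by blast
qed

lemma left_ideal_sum:
  assumes "left_ideal L" "left_ideal M"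
  shows "left_ideal {x + y |x y. x \<in> L \<and> y \<in> M}"
proof (rule left_idealI)
  show "0 \<in> {x + y |x y. x \<in> L \<and> y \<in> M}" using assms left_idealD(1) by force
next
  fix a b assume "a \<in> {x + y |x y. x \<in> L \<and> y \<in> M}" "b \<in> {x + y |x y. x \<in> L \<and> y \<in> M}"
  then obtain x y x' y' where "a = x + y" "b = x' + y'" "x \<in> L" "y \<in> M" "x' \<in> L" "y' \<in> M" by blast
  then have "a + b = (x + x') + (y + y')" "x + x' \<in> L" "y + y' \<in> M"
    using assms left_idealD(2) by auto
  then show "a + b \<in> {x + y |x y. x \<in> L \<and> y \<in> M}" by blast
next
  fix b a assume "a \<in> {x + y |x y. x \<in> L \<and> y \<in> M}"
  then obtain x y where "a = x + y" "x \<in> L" "y \<in> M" by blast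
  then have "b * a = b * x + b * y" "b * x \<in> L" "b * y \<in> M"
    using assms left_idealD(3) by (auto simp: distrib_left)
  then show "b * a \<in> {x + y |x y. x \<in> L \<and> y \<in> M}" by blast
qed

lemma left_ideal_principal: "left_ideal (range (\<lambda>b. b * u))"
proof (rule left_idealI)
  show "0 \<in> range (\<lambda>b. b * u)" by (rule range_eqI[of _ _ 0]) simp
qed (auto simp: distrib_right[symmetric] mult.assoc[symmetric])

text \<open>A nonzero left ideal is not contained in the radical, so some maximal left ideal omits
  one of its elements; the sum of the two ideals is the whole algebra.\<close>

lemma semisimple_one_decomposition:
  fixes L :: "'a::complex_banach_algebra_1 set"
  assumes ss: "semisimple TYPE('a)" and L: "left_ideal L" "L \<noteq> {0}"
  obtains x M p m where "x \<in> L" "maximal_left_ideal M" "x \<notin> M" "p \<in> L" "m \<in> M" "1 = p + m"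
proof -
  obtain x where x: "x \<in> L" "x \<noteq> 0" using L left_idealD(1) by blast
  have jac: "jacobson_radical = ({0} :: 'a set)" using ss by (simp only: semisimple_def)
  have "x \<notin> jacobson_radical" unfolding jac using x(2) by simp
  then obtain M where M: "maximal_left_ideal M" "x \<notin> M" unfolding jacobson_radical_def by blast
  define K where "K = {x + y |x y. x \<in> L \<and> y \<in> M}"
  have lM: "left_ideal M" using M unfolding maximal_left_ideal_def by blast
  have LK: "y \<in> K" if "y \<in> L" for y
    using that left_idealD(1)[OF lM] unfolding K_def by (intro CollectI exI[of _ y] exI[of _ 0]) simp
  have MK: "y \<in> K" if "y \<in> M" for y
    using that left_idealD(1)[OF L(1)] unfolding K_def by (intro CollectI exI[of _ 0] exI[of _ y]) simp
  have "left_ideal K" unfolding K_def by (rule left_ideal_sum[OF L(1) lM])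
  moreover have "K \<noteq> M" using LK[OF x(1)] M(2) by blast
  ultimately have "K = UNIV" using M(1) MK unfolding maximal_left_ideal_def by blast
  then obtain p m where "p \<in> L" "m \<in> M" "1 = p + m" unfolding K_def by blast
  then show ?thesis using that x(1) M by blast
qed

text \<open>If \<open>u A u = 0\<close>, then \<open>b * u\<close> has square zero, so
  \<open>m = 1 - b * u\<close> is invertible with inverse \<open>1 + b * u\<close> and cannot lie in
  a maximal left ideal.\<close>

lemma semisimple_semiprime:
  assumes ss: "semisimple TYPE('a::complex_banach_algebra_1)"
  shows "semiprime_banach TYPE('a)"
proof
  fix u :: 'a assume u: "\<And>z. u * z * u = 0"
  show "u = 0"
  proof (rule ccontr)
    assume "u \<noteq> 0"
    moreover have "1 * u \<in> range (\<lambda>b. b * u)" by blast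
    ultimately have "range (\<lambda>b. b * u) \<noteq> {0}" by auto
    then obtain M p m where M': "maximal_left_ideal M" "p \<in> range (\<lambda>b. b * u)" "m \<in> M" "1 = p + m"
      by (rule semisimple_one_decomposition[OF ss left_ideal_principal])
    then obtain b where M: "maximal_left_ideal M" "m \<in> M" "1 = b * u + m" by blast
    have m_eq: "m = 1 - b * u" using M(3) by (simp add: algebra_simps)
    have "b * u * (b * u) = 0" using u[of b] by (simp add: mult.assoc)
    then have m: "(1 + b * u) * m = 1" unfolding m_eq by (simp add: algebra_simps)
    have lM: "left_ideal M" using M unfolding maximal_left_ideal_def by blast
    have "y \<in> M" for y using left_idealD(3)[OF lM M(2), of "y * (1 + b * u)"] m by (simp add: mult.assoc)
    then show False using M(1) unfolding maximal_left_ideal_def by blast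
  qed
qed

text \<open>Brauer's lemma: \<open>L\<close> meets \<open>M\<close> in 0 by minimality, and
  \<open>x * m = x - x * p\<close> lies in both, so \<open>p\<close> is a right unit of
  \<open>L\<close>. Gelfand--Mazur then reduces \<open>pAp\<close> to scalars.\<close>

lemma minimal_left_ideal_minidem:
  fixes L :: "'a::complex_banach_algebra_1 set"
  assumes ss: "semisimple TYPE('a)" and L: "minimal_left_ideal L"
  obtains p where "minidem p" "\<And>x. x \<in> L \<Longrightarrow> x * p = x"
proof -
  have lL: "left_ideal L" and min: "\<And>K. left_ideal K \<Longrightarrow> K \<subseteq> L \<Longrightarrow> K = {0} \<or> K = L" and "L \<noteq> {0}"
    using L unfolding minimal_left_ideal_def by auto
  then obtain x0 M p m where d: "x0 \<in> L" "maximal_left_ideal M" "x0 \<notin> M" "p \<in> L" "m \<in> M" "1 = p + m"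
    using semisimple_one_decomposition[OF ss] by metis
  have lM: "left_ideal M" using d unfolding maximal_left_ideal_def by blast
  have "left_ideal (L \<inter> M)" using left_idealD[OF lL] left_idealD[OF lM] by (intro left_idealI) auto
  then have LM: "L \<inter> M = {0}" using min[of "L \<inter> M"] d by blast
  have xp: "x * p = x" if "x \<in> L" for x
  proof -
    have "x = x * p + x * m" using d(6) by (metis distrib_left mult_1_right)
    moreover from this have "x * m = x - x * p" by (simp add: algebra_simps)
    then have "x * m \<in> L \<inter> M" using that d lL lM left_idealD by (metis IntI)
    ultimately show ?thesis using LM by auto
  qed
  have p: "p * p = p" "p \<noteq> 0" using xp[OF d(4)] xp[OF d(1)] d left_idealD(1)[OF lM] by auto
  have left_inv: "\<exists>b. p * b = b \<and> b * p = b \<and> b * z = p" if z: "z \<noteq> 0" "p * z = z" "z * p = z" for z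
  proof -
    have "range (\<lambda>b. b * z) \<subseteq> L" using z left_idealD(3)[OF lL] d(4) by (metis image_subsetI mult.assoc)
    moreover have "1 * z \<in> range (\<lambda>b. b * z)" by blast
    ultimately have "range (\<lambda>b. b * z) = L" using min[OF left_ideal_principal] z(1) by (metis mult_1_left singletonD)
    then obtain b where "p = b * z" using d(4) by blast
    then have "p * (p * b * p) = p * b * p \<and> (p * b * p) * p = p * b * p \<and> (p * b * p) * z = p"
      using z p by (metis mult.assoc)
    then show ?thesis by blast
  qed
  have "\<exists>c. p * a * p = c *\<^sub>C p" for a
  proof -
    define y where "y = p * a * p"
    have y: "p * y = y" "y * p = y" unfolding y_def using p by (metis mult.assoc)+
    obtain l where l: "\<not> (\<exists>b. p * b = b \<and> b * p = b \<and> (y - l *\<^sub>C p) * b = p \<and> b * (y - l *\<^sub>C p) = p)"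
      using corner_spectrum_nonempty[OF p y] by blast
    define z where "z = y - l *\<^sub>C p"
    have z: "p * z = z" "z * p = z" unfolding z_def using y p by (simp_all add: cscale_algebra)
    \<comment> \<open>Otherwise \<open>z\<close> has a left inverse \<open>b\<close> in the corner
      and \<open>b\<close> has a left inverse too, which must be \<open>z\<close>. So
      \<open>b\<close> is two-sided, against the choice of \<open>l\<close>.\<close>
    have "z = 0"
    proof (rule ccontr)
      assume "z \<noteq> 0"
      then obtain b where b: "p * b = b" "b * p = b" "b * z = p" using left_inv z by blast
      then have "b \<noteq> 0" using p by auto
      then obtain b' where b': "b' * p = b'" "b' * b = p" using left_inv b by blast
      have "b' = z" using b b' z by (metis mult.assoc)
      then show False using l b b' unfolding z_def by blast
    qed
    then show ?thesis unfolding z_def y_def by (intro exI[of _ l]) simp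
  qed
  then show ?thesis using that p xp unfolding minidem_def by blast
qed

text \<open>A nonzero \<open>u = a * p\<close> in \<open>K\<close> is regular, and comparing scalars
  in \<open>u * v * u = u\<close> gives \<open>p * v * u = p\<close>, which places \<open>p\<close>
  in \<open>K\<close>.\<close>

lemma (in semiprime_banach) minidem_minimal_left_ideal:
  fixes p :: 'a
  assumes p: "minidem p"
  shows "minimal_left_ideal (range (\<lambda>b. b * p))"
  unfolding minimal_left_ideal_def
proof (intro conjI allI impI left_ideal_principal)
  have "1 * p \<in> range (\<lambda>b. b * p)" by blast
  then show "range (\<lambda>b. b * p) \<noteq> {0}" using minidem_nonzero[OF p] by auto
  fix K assume K: "left_ideal K \<and> K \<subseteq> range (\<lambda>b. b * p)"
  show "K = {0} \<or> K = range (\<lambda>b. b * p)"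
  proof (cases "K = {0}")
    case False
    then obtain u where u: "u \<in> K" "u \<noteq> 0" using K left_idealD(1) by blast
    then obtain a where a: "u = a * p" using K by blast
    obtain v where v: "u * v * u = u" using rank_one_regular[OF p, of a 1] a by auto
    have "u * v * u = a * (p * (v * a) * p)" unfolding a by (simp add: mult.assoc)
    then have "coef p (v * a) *\<^sub>C u = 1 *\<^sub>C u" using v a by (simp add: coef[OF p] cscale_simps)
    then have "coef p (v * a) = 1" using cscale_left_cancel u(2) by blast
    then have "p * v * u = p" using coef[OF p, of "v * a"] a by (simp add: mult.assoc cscale_one)
    then have "p \<in> K" using u(1) K left_idealD(3) by metis
    then show ?thesis using K left_idealD(3) by blast
  qed simp
qed

lemma socle_eq_finrank:
  assumes ss: "semisimple TYPE('a::complex_banach_algebra_1)"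
  shows "socle = (finrank :: 'a set)"
proof -
  interpret semiprime_banach "TYPE('a)" by (rule semisimple_semiprime[OF ss])
  have "x \<in> finrank" if "x \<in> socle" for x :: 'a
    using that
  proof induction
    case (socle_add L x s)
    obtain p where "minidem p" "x * p = x" using minimal_left_ideal_minidem[OF ss socle_add(1)] socle_add(2) by metis
    then have "x \<in> finrank" unfolding finrank_def by (intro CollectI exI[of _ "[p]"]) simp
    then show ?case using socle_add finrank_add by blast
  qed (rule finrank_zero)
  moreover have soc: "y * sum_list es \<in> socle" if "orth es" for es and y :: 'a
    using that
  proof (induction es)
    case (Cons e es)
    have "y * e + y * sum_list es \<in> socle"
      by (rule socle.socle_add[OF minidem_minimal_left_ideal[of e]]) (use Cons in auto)
    then show ?case by (simp add: distrib_left)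
  qed (simp add: socle.socle_zero)
  have "x \<in> socle" if x: "x \<in> finrank" for x :: 'a
  proof -
    obtain es where "orth es" "x * sum_list es = x" using x unfolding finrank_def by blast
    then show ?thesis using soc[of es x] by simp
  qed
  ultimately show ?thesis by blast
qed

section \<open>The index of Drazin invertible elements modulo a trace ideal\<close>

lemma invertible_el_one_minus:
  fixes z :: "'a::complex_banach_algebra_1"
  assumes "norm z < 1"
  shows "invertible_el (1 - z)"
proof -
  have sm: "summable (\<lambda>n. z ^ n)"
  proof (rule summable_comparison_test')
    show "summable (\<lambda>n. norm z ^ n)" using assms by (intro summable_geometric) simp
    show "norm (z ^ n) \<le> norm z ^ n" if "n \<ge> 0" for n by (rule norm_power_ineq)
  qed
  define s where "s = (\<Sum>n. z ^ n)"
  have "(\<lambda>n. z ^ Suc n) sums (s - 1)"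
  proof -
    have "(\<lambda>n. z ^ n) sums (s - 1 + z ^ 0)" using summable_sums[OF sm] by (simp add: s_def)
    then show ?thesis by (simp only: sums_Suc_iff)
  qed
  moreover have "(\<lambda>n. z ^ Suc n) sums (z * s)" unfolding power_Suc
    using summable_sums[OF sm] unfolding s_def[symmetric] by (rule sums_mult)
  moreover have "(\<lambda>n. z ^ Suc n) sums (s * z)" unfolding power_Suc2
    using summable_sums[OF sm] unfolding s_def[symmetric] by (rule sums_mult2)
  ultimately have "z * s = s - 1" "s * z = s - 1" using sums_unique2 by blast+
  then show ?thesis by (intro invertible_elI[of _ s]) (simp_all add: algebra_simps)
qed

locale trace_ideal =
  fixes J :: "'a::complex_banach_algebra_1 set" and T :: "'a \<Rightarrow> complex"
  assumes J_zero: "0 \<in> J" and J_add: "x \<in> J \<Longrightarrow> y \<in> J \<Longrightarrow> x + y \<in> J"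
    and J_left: "x \<in> J \<Longrightarrow> b * x \<in> J" and J_right: "x \<in> J \<Longrightarrow> x * b \<in> J"
    and T_add: "x \<in> J \<Longrightarrow> y \<in> J \<Longrightarrow> T (x + y) = T x + T y"
    and T_scale: "x \<in> J \<Longrightarrow> T (c *\<^sub>C x) = c * T x"
    and T_commute: "x \<in> J \<Longrightarrow> T (x * b) = T (b * x)"
begin

definition eqJ (infix "\<equiv>\<^sub>J" 50) where "x \<equiv>\<^sub>J y \<longleftrightarrow> x - y \<in> J"

lemma J_minus: "x \<in> J \<Longrightarrow> - x \<in> J"
  using J_left[of x "- 1"] by simp

lemma J_diff: "x \<in> J \<Longrightarrow> y \<in> J \<Longrightarrow> x - y \<in> J"
  using J_add[of x "- y"] J_minus by simp

lemma T_zero: "T 0 = 0"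
  using T_scale[OF J_zero, of 0] by simp

lemma T_diff: "x \<in> J \<Longrightarrow> y \<in> J \<Longrightarrow> T (x - y) = T x - T y"
  using T_add[of "x - y" y] J_diff by simp

lemma eqJ_refl [simp]: "x \<equiv>\<^sub>J x"
  unfolding eqJ_def using J_zero by simp

lemma eqJ_sym: "x \<equiv>\<^sub>J y \<Longrightarrow> y \<equiv>\<^sub>J x"
  unfolding eqJ_def using J_minus[of "x - y"] by simp

lemma eqJ_trans [trans]: "x \<equiv>\<^sub>J y \<Longrightarrow> y \<equiv>\<^sub>J z \<Longrightarrow> x \<equiv>\<^sub>J z"
  unfolding eqJ_def using J_add[of "x - y" "y - z"] by simp

lemma eqJ_add: "x \<equiv>\<^sub>J y \<Longrightarrow> u \<equiv>\<^sub>J v \<Longrightarrow> x + u \<equiv>\<^sub>J y + v"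
  unfolding eqJ_def using J_add[of "x - y" "u - v"] by (simp add: algebra_simps)

lemma eqJ_diff: "x \<equiv>\<^sub>J y \<Longrightarrow> u \<equiv>\<^sub>J v \<Longrightarrow> x - u \<equiv>\<^sub>J y - v"
  unfolding eqJ_def using J_diff[of "x - y" "u - v"] by (simp add: algebra_simps)

lemma eqJ_left: "x \<equiv>\<^sub>J y \<Longrightarrow> b * x \<equiv>\<^sub>J b * y"
  unfolding eqJ_def using J_left[of "x - y" b] by (simp add: algebra_simps)

lemma eqJ_right: "x \<equiv>\<^sub>J y \<Longrightarrow> x * b \<equiv>\<^sub>J y * b"
  unfolding eqJ_def using J_right[of "x - y" b] by (simp add: algebra_simps)

lemma eqJ_scale: "x \<equiv>\<^sub>J y \<Longrightarrow> c *\<^sub>C x \<equiv>\<^sub>J c *\<^sub>C y"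
  using eqJ_left[of x y "c *\<^sub>C 1"] by (simp add: cscale_simps)

abbreviation comm (infix "\<bowtie>" 50) where "x \<bowtie> y \<equiv> x * y \<equiv>\<^sub>J y * x"

lemma comm_sym: "x \<bowtie> y \<Longrightarrow> y \<bowtie> x"
  by (rule eqJ_sym)

lemma comm_mult:
  assumes "x \<bowtie> y" "x \<bowtie> z" shows "x \<bowtie> y * z"
proof -
  have "x * (y * z) \<equiv>\<^sub>J y * x * z" using eqJ_right[OF assms(1)] by (simp add: mult.assoc)
  also have "y * x * z = y * (x * z)" by (rule mult.assoc)
  also have "y * (x * z) \<equiv>\<^sub>J y * z * x" using eqJ_left[OF assms(2)] by (simp add: mult.assoc)
  finally show ?thesis .
qed

lemma comm_diff: "x \<bowtie> y \<Longrightarrow> x \<bowtie> z \<Longrightarrow> x \<bowtie> y - z"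
  using eqJ_diff[of "x * y" "y * x" "x * z" "z * x"] by (simp add: algebra_simps)

lemma comm_add: "x \<bowtie> y \<Longrightarrow> x \<bowtie> z \<Longrightarrow> x \<bowtie> y + z"
  using eqJ_add[of "x * y" "y * x" "x * z" "z * x"] by (simp add: algebra_simps)

lemma comm_scale: "x \<bowtie> y \<Longrightarrow> x \<bowtie> c *\<^sub>C y"
  using eqJ_scale[of "x * y" "y * x" c] by (simp add: cscale_simps)

lemma comm_power: "x \<bowtie> y \<Longrightarrow> x \<bowtie> y ^ n"
  by (induction n) (auto intro: comm_mult)

lemma comm_cong: "x \<bowtie> y \<Longrightarrow> y \<equiv>\<^sub>J z \<Longrightarrow> x \<bowtie> z"
  by (meson eqJ_left eqJ_right eqJ_sym eqJ_trans)

text \<open>The Helton--Howe trace form on pairs that commute modulo the ideal.\<close>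

definition om where "om x y = T (x * y - y * x)"

lemma om_cong:
  assumes "x \<bowtie> y" "y \<equiv>\<^sub>J z"
  shows "om x y = om x z"
proof -
  have yz: "y - z \<in> J" and xy: "x * y - y * x \<in> J" using assms unfolding eqJ_def by auto
  have xz: "x * z - z * x \<in> J" using comm_cong[OF assms] unfolding eqJ_def .
  have "x * y - y * x = (x * z - z * x) + (x * (y - z) - (y - z) * x)" by (simp add: algebra_simps)
  then have "om x y = om x z + T (x * (y - z) - (y - z) * x)"
    unfolding om_def using T_add[OF xz J_diff[OF J_left[OF yz] J_right[OF yz]], of x x] by simp
  also have "T (x * (y - z) - (y - z) * x) = 0"
    using T_diff[OF J_left[OF yz, of x] J_right[OF yz, of x]] T_commute[OF yz, of x] by simp
  finally show ?thesis by simp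
qed

lemma om_antisym: "x \<bowtie> y \<Longrightarrow> om y x = - om x y"
  unfolding om_def eqJ_def using T_scale[of "x * y - y * x" "- 1"] by (simp add: cs.minus_left cscale_one)

lemma om_cong_left: "x \<bowtie> y \<Longrightarrow> x \<equiv>\<^sub>J z \<Longrightarrow> om x y = om z y"
  using om_cong[of y x z] om_antisym[of y x] om_antisym[of y z] comm_sym comm_cong by metis

lemma om_commute: "x * y = y * x \<Longrightarrow> om x y = 0"
  unfolding om_def using T_zero by simp

lemma om_add:
  assumes "x \<bowtie> y" "x \<bowtie> z"
  shows "om x (y + z) = om x y + om x z"
proof -
  have "x * (y + z) - (y + z) * x = (x * y - y * x) + (x * z - z * x)" by (simp add: algebra_simps)
  then show ?thesis unfolding om_def using assms T_add unfolding eqJ_def by simp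
qed

lemma om_scale: "x \<bowtie> y \<Longrightarrow> om x (c *\<^sub>C y) = c * om x y"
  unfolding om_def eqJ_def using T_scale[of "x * y - y * x" c]
  by (simp add: cscale_simps cs.diff_right)

lemma om_diff:
  assumes "x \<bowtie> y" "x \<bowtie> z"
  shows "om x (y - z) = om x y - om x z"
  using om_add[of x "y - z" z] comm_diff assms by simp

text \<open>The three commutators cancel identically in \<open>A\<close>; commutation modulo
  \<open>J\<close> puts each of them in \<open>J\<close>, where \<open>T\<close> is
  additive.\<close>

lemma om_cocycle:
  assumes "x \<bowtie> y" "y \<bowtie> z" "z \<bowtie> x"
  shows "om (x * y) z + om (y * z) x + om (z * x) y = 0"
proof -
  have "x * y \<bowtie> z" "y * z \<bowtie> x" "z * x \<bowtie> y" using assms comm_mult comm_sym by metis+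
  then have "om (x * y) z + om (y * z) x + om (z * x) y
     = T ((x * y * z - z * (x * y)) + (y * z * x - x * (y * z)) + (z * x * y - y * (z * x)))"
    unfolding om_def eqJ_def by (simp add: T_add J_add)
  also have "(x * y * z - z * (x * y)) + (y * z * x - x * (y * z)) + (z * x * y - y * (z * x)) = 0"
    by (simp add: algebra_simps)
  finally show ?thesis using T_zero by simp
qed

text \<open>The cocycle identity for \<open>h, e, e\<close> gives
  \<open>2 * om (h * e) e = om h e\<close>. With \<open>h = g * e\<close>, where
  \<open>h * e\<close> is congruent to \<open>h\<close>, it forces \<open>om (g * e) e = 0\<close>;
  with \<open>h = g\<close> it then gives the claim.\<close>

lemma om_idempotent:
  assumes "e * e \<equiv>\<^sub>J e" "g \<bowtie> e"
  shows "om g e = 0"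
proof -
  have *: "2 * om (h * e) e = om h e" if h: "h \<bowtie> e" for h
  proof -
    have eh: "e \<bowtie> h" using h by (rule comm_sym)
    have "om (h * e) e + om (e * e) h + om (e * h) e = 0" by (rule om_cocycle[OF h _ eh]) simp
    moreover have "om (e * e) h = om e h" using om_cong_left[OF _ assms(1)] eh comm_mult comm_sym by metis
    moreover have "om e h = - om h e" by (rule om_antisym[OF h])
    moreover have "om (e * h) e = om (h * e) e"
      by (rule om_cong_left[OF _ eh]) (use h comm_mult comm_sym eqJ_refl in metis)
    ultimately show ?thesis by simp
  qed
  have ge: "g * e \<bowtie> e" using assms(2) comm_mult comm_sym eqJ_refl by metis
  have gee: "g * e * e \<bowtie> e" by (rule comm_sym, rule comm_mult[OF comm_sym[OF ge] eqJ_refl])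
  have "g * e * e \<equiv>\<^sub>J g * e" using eqJ_left[OF assms(1), of g] by (simp add: mult.assoc)
  then have "om (g * e * e) e = om (g * e) e" by (rule om_cong_left[OF gee])
  then show ?thesis using *[OF ge] *[OF assms(2)] by simp
qed

text \<open>In terms of differentials: $e\, a^m da = e\, d(a^{m+1}) / (m+1)$ is exact up to $a^{m+1} de = 0$.\<close>

lemma om_idempotent_power:
  assumes "e * e \<equiv>\<^sub>J e" "a \<bowtie> e"
  shows "om (e * a ^ m) a = 0"
proof -
  have ea: "e \<bowtie> a" using assms(2) by (rule comm_sym)
  have cp: "e * a ^ i \<bowtie> a" for i
    by (rule comm_sym, rule comm_mult[OF assms(2)]) (simp add: power_commutes)
  \<comment> \<open>The power rule, \<open>d(a^(j+1)) = (j+1) a^j da\<close>: each use of the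
    cocycle identity moves one factor \<open>a\<close> to the left. The case \<open>i = 0\<close>,
    \<open>j = m\<close> is compared below with the vanishing of \<open>om\<close> on
    idempotents.\<close>
  have W: "om (e * a ^ i) (a ^ Suc j) = of_nat (Suc j) * om (e * a ^ (i + j)) a" for i j
  proof (induction j arbitrary: i)
    case (Suc j)
    have "om (e * a ^ i * a ^ Suc j) a + om (a ^ Suc j * a) (e * a ^ i) + om (a * (e * a ^ i)) (a ^ Suc j) = 0"
      by (rule om_cocycle[OF comm_power[OF cp] _ comm_sym[OF cp]]) (simp add: power_commutes mult.assoc)
    moreover have "e * a ^ i * a ^ Suc j = e * a ^ (i + Suc j)" by (simp only: mult.assoc power_add)
    moreover have "a ^ Suc j * a = a ^ Suc (Suc j)" by (simp only: power_Suc2)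
    moreover have "om (a ^ Suc (Suc j)) (e * a ^ i) = - om (e * a ^ i) (a ^ Suc (Suc j))"
      by (rule om_antisym[OF comm_power[OF cp]])
    moreover have "om (a * (e * a ^ i)) (a ^ Suc j) = om (e * a ^ Suc i) (a ^ Suc j)"
    proof (rule om_cong_left)
      show "a * (e * a ^ i) \<bowtie> a ^ Suc j"
        using cp[of i] comm_power comm_mult comm_sym eqJ_refl by metis
      show "a * (e * a ^ i) \<equiv>\<^sub>J e * a ^ Suc i"
        using eqJ_right[OF assms(2), of "a ^ i"] by (simp add: mult.assoc)
    qed
    ultimately have "om (e * a ^ i) (a ^ Suc (Suc j)) = om (e * a ^ (i + Suc j)) a + om (e * a ^ Suc i) (a ^ Suc j)"
      by (simp add: algebra_simps)
    then show ?case unfolding Suc by (simp add: algebra_simps)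
  qed simp
  have "om e (a ^ Suc m) = - om (a ^ Suc m) e" by (rule om_antisym[OF comm_sym[OF comm_power[OF ea]]])
  also have "om (a ^ Suc m) e = 0" by (rule om_idempotent[OF assms(1) comm_sym[OF comm_power[OF ea]]])
  finally have "of_nat (Suc m) * om (e * a ^ m) a = 0" using W[of 0 m] by simp
  then show ?thesis by (simp del: of_nat_Suc)
qed

section \<open>Drazin inverses modulo the ideal and the inverse of the shifted element\<close>

lemma drazin_inv_mod_iff:
  "drazin_inv_mod J a b \<longleftrightarrow> a \<bowtie> b \<and> b * a * b \<equiv>\<^sub>J b \<and> (\<exists>k\<ge>1. a ^ k * b * a \<equiv>\<^sub>J a ^ k)"
  unfolding drazin_inv_mod_def eqJ_def ..

text \<open>\<open>bf_index\<close> selects a Drazin inverse for Fredholm elements as well; this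
  makes their inverses admissible choices.\<close>

lemma drazin_inv_mod_of_inverse:
  assumes "a * b \<equiv>\<^sub>J 1" "b * a \<equiv>\<^sub>J 1"
  shows "drazin_inv_mod J a b"
  unfolding drazin_inv_mod_iff
proof (intro conjI exI[of _ "1::nat"])
  show "a \<bowtie> b" using assms eqJ_sym eqJ_trans by blast
  show "b * a * b \<equiv>\<^sub>J b" using eqJ_right[OF assms(2), of b] by simp
  show "a ^ 1 * b * a \<equiv>\<^sub>J a ^ 1" using eqJ_right[OF assms(1), of a] by simp
qed simp

text \<open>Both \<open>b\<close> and \<open>c\<close> can be padded with arbitrarily high powers of
  \<open>a\<close>. Powers high enough for the condition of the other inverse show
  \<open>b * a * c\<close> to be congruent to \<open>b\<close> and to \<open>c\<close>.\<close>

lemma drazin_inv_mod_unique: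
  assumes b: "drazin_inv_mod J a b" and c: "drazin_inv_mod J a c"
  shows "b \<equiv>\<^sub>J c"
proof -
  obtain k l where k: "a ^ k * b * a \<equiv>\<^sub>J a ^ k" and l: "a ^ l * c * a \<equiv>\<^sub>J a ^ l"
    and ab: "a \<bowtie> b" and ac: "a \<bowtie> c" and bab: "b * a * b \<equiv>\<^sub>J b" and cac: "c * a * c \<equiv>\<^sub>J c"
    using b c unfolding drazin_inv_mod_iff by blast
  have b1: "b \<equiv>\<^sub>J b ^ Suc i * a ^ i" for i
  proof (induction i)
    case (Suc i)
    have "b * (a * b) \<equiv>\<^sub>J b * (b * a)" by (rule eqJ_left[OF ab])
    then have "b \<equiv>\<^sub>J b * b * a" using bab eqJ_sym eqJ_trans by (metis mult.assoc)
    then have "b ^ i * b * a ^ i \<equiv>\<^sub>J b ^ i * (b * b * a) * a ^ i" by (intro eqJ_right eqJ_left)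
    also have "b ^ i * (b * b * a) * a ^ i = b ^ Suc (Suc i) * a ^ Suc i"
      by (simp only: power_Suc2[of b] power_Suc[of a] mult.assoc)
    finally show ?case using Suc eqJ_trans by (metis power_Suc2)
  qed simp
  have c1: "c \<equiv>\<^sub>J a ^ i * c ^ Suc i" for i
  proof (induction i)
    case (Suc i)
    have "c * a * c \<equiv>\<^sub>J a * c * c" using eqJ_right[OF comm_sym[OF ac], of c] by simp
    then have "c \<equiv>\<^sub>J a * c * c" using cac eqJ_sym eqJ_trans by blast
    then have "a ^ i * c * c ^ i \<equiv>\<^sub>J a ^ i * (a * c * c) * c ^ i" by (intro eqJ_right eqJ_left)
    also have "a ^ i * (a * c * c) * c ^ i = a ^ Suc i * c ^ Suc (Suc i)"
      by (simp only: power_Suc2[of a] power_Suc[of c] mult.assoc)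
    finally show ?case using Suc eqJ_trans by (metis power_Suc mult.assoc)
  qed simp
  have ca: "a ^ l * a * c \<equiv>\<^sub>J a ^ l" 
    using eqJ_left[OF ac, of "a ^ l"] l eqJ_trans by (metis mult.assoc)
  have ba: "b * a * a ^ k \<equiv>\<^sub>J a ^ k"
  proof -
    have "b * (a * a ^ k) \<equiv>\<^sub>J a * a ^ k * b" by (rule comm_mult) (use comm_sym[OF ab] comm_power in blast)+
    also have "a * a ^ k * b = a ^ k * (a * b)" by (metis mult.assoc power_commutes)
    also have "a ^ k * (a * b) \<equiv>\<^sub>J a ^ k * (b * a)" by (rule eqJ_left[OF ab])
    finally show ?thesis using k eqJ_trans by (metis mult.assoc)
  qed
  have "b * (a * c) \<equiv>\<^sub>J b ^ Suc l * a ^ l * (a * c)" by (rule eqJ_right[OF b1])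
  also have "b ^ Suc l * a ^ l * (a * c) = b ^ Suc l * (a ^ l * a * c)" by (simp only: mult.assoc)
  also have "b ^ Suc l * (a ^ l * a * c) \<equiv>\<^sub>J b ^ Suc l * a ^ l" by (rule eqJ_left[OF ca])
  also have "b ^ Suc l * a ^ l \<equiv>\<^sub>J b" by (rule eqJ_sym[OF b1])
  finally have bac: "b * (a * c) \<equiv>\<^sub>J b" .
  have "b * a * c \<equiv>\<^sub>J b * a * (a ^ k * c ^ Suc k)" by (rule eqJ_left[OF c1])
  also have "b * a * (a ^ k * c ^ Suc k) = b * a * a ^ k * c ^ Suc k" by (simp only: mult.assoc)
  also have "b * a * a ^ k * c ^ Suc k \<equiv>\<^sub>J a ^ k * c ^ Suc k" by (rule eqJ_right[OF ba])
  also have "a ^ k * c ^ Suc k \<equiv>\<^sub>J c" by (rule eqJ_sym[OF c1])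
  finally have "b * (a * c) \<equiv>\<^sub>J c" by (simp add: mult.assoc)
  then show ?thesis using bac eqJ_sym eqJ_trans by blast
qed

lemma index_eq:
  assumes "drazin_inv_mod J a b"
  shows "T (a * (SOME b. drazin_inv_mod J a b) - (SOME b. drazin_inv_mod J a b) * a) = om a b"
proof -
  define c where "c = (SOME b. drazin_inv_mod J a b)"
  have c: "drazin_inv_mod J a c" unfolding c_def using assms by (rule someI)
  have "om a c = om a b"
    by (rule om_cong) (use c drazin_inv_mod_unique[OF c assms] drazin_inv_mod_iff in auto)
  then show ?thesis unfolding om_def c_def .
qed

lemma shifted_inverse:
  assumes b: "drazin_inv_mod J a b" and l: "l \<noteq> 0" "norm (l *\<^sub>C b) < 1"
  shows "\<exists>c. (a - l *\<^sub>C 1) * c \<equiv>\<^sub>J 1 \<and> c * (a - l *\<^sub>C 1) \<equiv>\<^sub>J 1 \<and> om (a - l *\<^sub>C 1) c = om a b"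
proof -
  obtain k where ab: "a \<bowtie> b" and bab: "b * a * b \<equiv>\<^sub>J b" and k: "a ^ k * b * a \<equiv>\<^sub>J a ^ k"
    using b unfolding drazin_inv_mod_iff by blast
  obtain r where r: "(1 - l *\<^sub>C b) * r = 1" "r * (1 - l *\<^sub>C b) = 1"
    using invertible_el_one_minus[OF l(2)] unfolding invertible_el_def by blast
  have rb: "b * r = r * b" by (rule inverse_commute[OF r]) (simp add: cscale_algebra)
  define e where "e = a * b"
  define f where "f = 1 - e"
  have ba: "b \<bowtie> a" by (rule comm_sym[OF ab])
  have ae: "a \<bowtie> e" unfolding e_def by (rule comm_mult[OF _ ab]) simp
  have be: "b \<bowtie> e" unfolding e_def by (rule comm_mult[OF ba]) simp
  have ar: "a \<bowtie> r"
  proof -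
    have "a \<bowtie> 1 - l *\<^sub>C b" by (intro comm_diff comm_scale ab) simp
    then have "r * (a * (1 - l *\<^sub>C b)) * r \<equiv>\<^sub>J r * ((1 - l *\<^sub>C b) * a) * r" by (intro eqJ_left eqJ_right)
    moreover have "r * (a * (1 - l *\<^sub>C b)) * r = r * a" using r(1) by (simp add: mult.assoc)
    moreover have "r * ((1 - l *\<^sub>C b) * a) * r = a * r" using r(2) by (simp add: mult.assoc[symmetric])
    ultimately show ?thesis using eqJ_sym by simp
  qed
  have br: "b \<bowtie> r" using rb by simp
  have re: "r \<bowtie> e" unfolding e_def by (rule comm_mult) (use ar br comm_sym in auto)
  have ee: "e * e \<equiv>\<^sub>J e"
    unfolding e_def using eqJ_left[OF bab, of a] by (simp add: mult.assoc)
  have eb: "e * b \<equiv>\<^sub>J b"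
  proof -
    have "e * b \<equiv>\<^sub>J b * e" by (rule comm_sym[OF be])
    also have "b * e \<equiv>\<^sub>J b" unfolding e_def using bab by (simp add: mult.assoc)
    finally show ?thesis .
  qed
  \<comment> \<open>The geometric series for the inverse of \<open>l - a\<close> on
    \<open>f\<close>, where \<open>a\<close> is nilpotent modulo \<open>J\<close>. It inverts
    \<open>l - a\<close> and not \<open>a - l\<close>, hence the minus sign in
    \<open>c\<close>.\<close>
  define g where "g n = (\<Sum>i<n. (inverse l ^ Suc i) *\<^sub>C (a ^ i * f))" for n
  have tele: "(a - l *\<^sub>C 1) * g n = inverse l ^ n *\<^sub>C (a ^ n * f) - f" for n
  proof (induction n)
    case (Suc n)
    define d where "d = inverse l ^ Suc n"
    have d: "l * d = inverse l ^ n" unfolding d_def using l(1) by simp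
    have "(a - l *\<^sub>C 1) * (d *\<^sub>C (a ^ n * f)) = d *\<^sub>C (a ^ Suc n * f) - (l * d) *\<^sub>C (a ^ n * f)"
      by (simp add: left_diff_distrib cscale_simps cs.diff_right mult.assoc mult.commute[of d l])
    then have "(a - l *\<^sub>C 1) * (inverse l ^ Suc n *\<^sub>C (a ^ n * f))
       = inverse l ^ Suc n *\<^sub>C (a ^ Suc n * f) - inverse l ^ n *\<^sub>C (a ^ n * f)"
      unfolding d unfolding d_def .
    moreover have "g (Suc n) = g n + inverse l ^ Suc n *\<^sub>C (a ^ n * f)" unfolding g_def by simp
    ultimately show ?case using Suc by (simp add: distrib_left)
  qed (simp add: g_def cscale_one)
  have af: "a \<bowtie> f" unfolding f_def by (rule comm_diff[OF _ ae]) simp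
  have aif: "a \<bowtie> a ^ i * f" for i by (rule comm_mult[OF _ af]) (simp add: power_commutes)
  have om_aif: "om a (a ^ i * f) = 0" for i
  proof -
    have aie: "a \<bowtie> a ^ i * e" by (rule comm_mult[OF _ ae]) (simp add: power_commutes)
    have "om a (a ^ i * f) = om a (a ^ i) - om a (a ^ i * e)"
      unfolding f_def right_diff_distrib using om_diff[OF _ aie, of "a ^ i"] by (simp add: power_commutes)
    also have "om a (a ^ i) = 0" by (rule om_commute) (simp add: power_commutes)
    also have "om a (a ^ i * e) = om a (e * a ^ i)"
      by (rule om_cong[OF aie], rule comm_sym, rule comm_power[OF comm_sym[OF ae]])
    also have "om a (e * a ^ i) = - om (e * a ^ i) a"
      by (rule om_antisym, rule comm_sym, rule comm_mult[OF ae]) (simp add: power_commutes)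
    also have "om (e * a ^ i) a = 0" by (rule om_idempotent_power[OF ee ae])
    finally show ?thesis by simp
  qed
  have g: "a \<bowtie> g n \<and> om a (g n) = 0" for n
  proof (induction n)
    case (Suc n)
    have "g (Suc n) = g n + inverse l ^ Suc n *\<^sub>C (a ^ n * f)" unfolding g_def by simp
    then show ?case using Suc om_add[OF _ comm_scale[OF aif]] comm_add[OF _ comm_scale[OF aif]]
        om_scale[OF aif] om_aif by simp
  qed (simp add: g_def om_commute)
  have akf: "a ^ k * f \<equiv>\<^sub>J 0"
  proof -
    have "a ^ k * (a * b) \<equiv>\<^sub>J a ^ k * (b * a)" by (rule eqJ_left[OF ab])
    then have "a ^ k * e \<equiv>\<^sub>J a ^ k" unfolding e_def using k eqJ_trans by (metis mult.assoc)
    from eqJ_diff[OF eqJ_refl[of "a ^ k"] this] show ?thesis unfolding f_def by (simp add: right_diff_distrib)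
  qed
  have g1: "(a - l *\<^sub>C 1) * g k \<equiv>\<^sub>J - f"
    unfolding tele using eqJ_diff[OF eqJ_scale[OF akf, of "inverse l ^ k"] eqJ_refl[of f]] by simp
  define c where "c = b * r - g k"
  have abr: "a \<bowtie> b * r" by (rule comm_mult[OF ab ar])
  have ac: "a \<bowtie> c" unfolding c_def by (rule comm_diff[OF abr]) (use g in blast)
  \<comment> \<open>Modulo \<open>J\<close>, \<open>e - l b\<close> is \<open>e * (1 - l b)\<close>,
    and \<open>r\<close> cancels the second factor.\<close>
  have "(a - l *\<^sub>C 1) * (b * r) = (e - l *\<^sub>C b) * r" unfolding e_def by (simp add: cscale_algebra)
  also have "(e - l *\<^sub>C b) * r \<equiv>\<^sub>J (e - l *\<^sub>C (e * b)) * r"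
    by (intro eqJ_right eqJ_diff eqJ_scale eqJ_refl eqJ_sym[OF eb])
  also have "(e - l *\<^sub>C (e * b)) * r = e * ((1 - l *\<^sub>C b) * r)" by (simp add: cscale_algebra)
  also have "\<dots> = e" using r by simp
  finally have "(a - l *\<^sub>C 1) * (b * r) \<equiv>\<^sub>J e" .
  from eqJ_diff[OF this g1] have c1: "(a - l *\<^sub>C 1) * c \<equiv>\<^sub>J 1"
    unfolding c_def f_def by (simp add: right_diff_distrib)
  have "c * (a - l *\<^sub>C 1) - (a - l *\<^sub>C 1) * c = c * a - a * c" by (simp add: cscale_algebra)
  then have "c * (a - l *\<^sub>C 1) \<equiv>\<^sub>J (a - l *\<^sub>C 1) * c" using comm_sym[OF ac] unfolding eqJ_def by simp
  then have c2: "c * (a - l *\<^sub>C 1) \<equiv>\<^sub>J 1" using c1 eqJ_trans by blast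
  have "om (a - l *\<^sub>C 1) c = om a c" unfolding om_def by (simp add: cscale_algebra)
  also have "\<dots> = om a (b * r)" unfolding c_def using om_diff[OF abr, of "g k"] g by simp
  also have "\<dots> = - om (b * r) a" by (rule om_antisym[OF comm_sym[OF abr]])
  \<comment> \<open>Cocycle identity for \<open>a\<close>, \<open>b\<close>, \<open>r\<close>. The
    first term vanishes because \<open>a * b\<close> is idempotent modulo \<open>J\<close>; the
    second must be brought back to \<open>om a b\<close>.\<close>
  also have "\<dots> = om (a * b) r + om (r * a) b" 
    using om_cocycle[OF ab br comm_sym[OF ar]] by (simp add: add_eq_0_iff)
  also have "om (a * b) r = 0"
    using om_antisym[OF re] om_idempotent[OF ee re] unfolding e_def by simp
  also have "om (r * a) b = om a b"
  proof -
    \<comment> \<open>Expanding \<open>r\<close> once makes \<open>r * a\<close> congruent to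
      \<open>a + l (r * e)\<close>, which isolates \<open>om a b\<close> and leaves an error term in
      \<open>om b (r * e)\<close>.\<close>
    have r1: "r = 1 + l *\<^sub>C (b * r)" using r(1) by (simp add: left_diff_distrib cscale_mult_left algebra_simps)
    have "r * a = a + l *\<^sub>C (b * r) * a" by (subst r1) (simp add: distrib_right)
    also have "\<dots> = a + l *\<^sub>C (r * (b * a))" unfolding rb by (simp add: cscale_mult_left mult.assoc)
    finally have ra: "r * a \<equiv>\<^sub>J a + l *\<^sub>C (r * e)"
      unfolding e_def by (simp only:) (intro eqJ_add eqJ_refl eqJ_scale eqJ_left ba)
    have bre: "b \<bowtie> r * e" by (rule comm_mult[OF br be])
    have "om (r * a) b = om (a + l *\<^sub>C (r * e)) b"
      by (rule om_cong_left[OF _ ra]) (use comm_mult[OF br ba] comm_sym in blast)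
    also have "\<dots> = - om b (a + l *\<^sub>C (r * e))"
      by (rule om_antisym, rule comm_add[OF ba comm_scale[OF bre]])
    also have "\<dots> = - om b a - l * om b (r * e)"
      using om_add[OF ba comm_scale[OF bre]] om_scale[OF bre] by simp
    also have "om b a = - om a b" by (rule om_antisym[OF ab])
    \<comment> \<open>Cocycle identity for \<open>r\<close>, \<open>e\<close>, \<open>b\<close>: one
      term pairs with the idempotent \<open>e\<close>, and another reduces to \<open>om b r\<close>,
      which is 0 because \<open>b\<close> and \<open>r\<close> commute exactly.\<close>
    also have "om b (r * e) = 0"
    proof -
      have eb': "e \<bowtie> b" by (rule comm_sym[OF be])
      have "om (r * e) b + om (e * b) r + om (b * r) e = 0"
        by (rule om_cocycle[OF re eb' br])
      moreover have "om (b * r) e = 0"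
        by (rule om_idempotent[OF ee], rule comm_sym, rule comm_mult[OF eb' comm_sym[OF re]])
      moreover have "om (e * b) r = om b r"
        by (rule om_cong_left[OF _ eb], rule comm_sym, rule comm_mult[OF re comm_sym[OF br]])
      moreover have "om b r = 0" by (rule om_commute[OF rb])
      moreover have "om b (r * e) = - om (r * e) b" by (rule om_antisym[OF comm_sym[OF bre]])
      ultimately show ?thesis by simp
    qed
    finally show ?thesis by simp
  qed
  finally have "om (a - l *\<^sub>C 1) c = om a b" by simp
  then show ?thesis using c1 c2 by blast
qed

end

lemma trace_ideal_socle:
  assumes ss: "semisimple TYPE('a::complex_banach_algebra_1)"
  shows "trace_ideal (socle :: 'a set) soc_trace"
proof -
  interpret semiprime_banach "TYPE('a)" by (rule semisimple_semiprime[OF ss])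
  show ?thesis
    unfolding socle_eq_finrank[OF ss]
  proof
    fix x y b :: 'a and c
    show "(0::'a) \<in> finrank" by (rule finrank_zero)
    assume x: "x \<in> finrank"
    show left: "b * x \<in> finrank" and right: "x * b \<in> finrank"
      using x finrank_mult_left finrank_mult_right by blast+
    show "soc_trace (c *\<^sub>C x) = c * soc_trace x"
      using x by (simp add: soc_trace_eq_ftrace finrank_scale ftrace_scale)
    show "soc_trace (x * b) = soc_trace (b * x)"
      using left right ftrace_mult_commute[OF x] by (simp add: soc_trace_eq_ftrace)
    assume y: "y \<in> finrank"
    show "x + y \<in> finrank" using x y by (rule finrank_add)
    then show "soc_trace (x + y) = soc_trace x + soc_trace y"
      using x y by (simp add: soc_trace_eq_ftrace ftrace_add)
  qed
qed

theorem theorem3p1: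
  fixes a :: "'a::complex_banach_algebra_1"
  assumes "semisimple TYPE('a)"
    and "B_fredholm_mod socle a"
  shows "\<exists>\<epsilon>>0. \<forall>l::complex. 0 < cmod l \<and> cmod l < \<epsilon> \<longrightarrow>
           fredholm_mod socle (a - l *\<^sub>C 1) \<and>
           bf_index socle (a - l *\<^sub>C 1) = bf_index socle a"
proof -
  interpret trace_ideal socle "soc_trace :: 'a \<Rightarrow> complex"
    by (rule trace_ideal_socle[OF assms(1)])
  obtain b where b: "drazin_inv_mod socle a b" using assms(2) unfolding B_fredholm_mod_def by blast
  have index: "bf_index socle x = om x y" if "drazin_inv_mod socle x y" for x y :: 'a
    unfolding bf_index_def Let_def by (rule index_eq[OF that])
  have pos: "norm b + 1 > 0" by (simp add: add_nonneg_pos)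
  show ?thesis
  \<comment> \<open>This radius ensures \<open>norm (l b) < 1\<close>; the added 1 allows for
    \<open>b = 0\<close>.\<close>
  proof (intro exI[of _ "1 / (norm b + 1)"] conjI allI impI)
    show "1 / (norm b + 1) > 0" using pos by simp
    fix l :: complex assume l: "0 < cmod l \<and> cmod l < 1 / (norm b + 1)"
    then have "cmod l * norm b + cmod l < 1" using pos by (simp add: field_simps)
    moreover have l0: "l \<noteq> 0" "cmod l > 0" using l by auto
    ultimately have "norm (l *\<^sub>C b) < 1" unfolding norm_cscale by linarith
    then obtain c where c: "eqJ ((a - l *\<^sub>C 1) * c) 1" "eqJ (c * (a - l *\<^sub>C 1)) 1"
      "om (a - l *\<^sub>C 1) c = om a b"
      using shifted_inverse[OF b l0(1)] by blast
    show "fredholm_mod socle (a - l *\<^sub>C 1)"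
      using c(1,2) unfolding fredholm_mod_def eqJ_def by blast
    show "bf_index socle (a - l *\<^sub>C 1) = bf_index socle a"
      using index[OF drazin_inv_mod_of_inverse[OF c(1,2)]] index[OF b] c(3) by simp
  qed
qed

end
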